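(* (Paley–Wiener theorem for the Mellin transform.) For every $c\in\mathbb{R}$ and $T>0$, $\widetilde{B}^2_{c,T}=B^2_{c,T}$.
   Context: $\mathbb{R}^+=(0,\infty)$, $\Omega=\mathbb{C}\setminus[0,\infty)$. For $c\in\mathbb{R}$, $X^2_c$ is the space of measurable $f:\mathbb{R}^+\to\mathbb{C}$ with $f(x)x^{c-1/2}\in L^2(\mathbb{R}^+)$. For $f\in X^2_c$ the Mellin transform $[f]^\wedge_{M^2}(c+it)$, $t\in\mathbb{R}$, is the $L^2(\mathbb{R})$-limit as $\rho\to\infty$ of $\int_{1/\rho}^{\rho} f(u)u^{c+it-1}\,du$. $B^2_{c,T}$ is the set of $f\in X^2_c\cap C(\mathbb{R}^+)$ such that $[f]^\wedge_{M^2}(c+it)=0$ for almost every $|t|>T$. The Mellin–Bernstein space $\widetilde{B}^2_{c,T}$ consists of all $f\in X^2_c$ such that $g(x):=x^cf(x)$ has an analytic extension to the Riemann surface of the logarithm, given by analytic branches $g_k:\Omega\to\mathbb{C}$, $k\in\mathbb{Z}$, with: (i) for every $x>0$ the limits $g_k^+(x)=\lim_{\varepsilon\to0^+}g_k(x+i\varepsilon)$ and $g_k^-(x)=\lim_{\varepsilon\to0^+}g_k(x-i\varepsilon)$ exist, $g_k^-(x)=g_{k+1}^+(x)$, and $g_0^+(x)=g(x)$; (ii) for every $x>0$ and every open disk $U_x$ in the right half-plane centered at $x$, the function $\psi_k:U_x\to\mathbb{C}$ equal to $g_k(z)$ for $\Im z<0$, to $g_k^-(z)$ for $z\in U_x\cap\mathbb{R}$,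 and to $g_{k+1}(z)$ for $\Im z>0$, is analytic; (iii) there is $C>0$ such that $|g_k(re^{i\theta})|\le Ce^{T|2\pi k+\theta|}$ for all $k\in\mathbb{Z}$, $\theta\in[0,2\pi]$, $r>0$; (iv) for each $k$, $\lim_{r\to0}g_k(re^{i\theta})=\lim_{r\to\infty}g_k(re^{i\theta})=0$ uniformly in $\theta\in[0,2\pi]$. In (iii) and (iv), $g_k(re^{i0})$ means $g_k^+(r)$ and $g_k(re^{2\pi i})$ means $g_k^-(r)$. *)

theory Defs
  imports "HOL-Complex_Analysis.Complex_Analysis"
begin

definition X2 :: "real \<Rightarrow> (real \<Rightarrow> complex) set" where
  "X2 c = {f. set_borel_measurable lebesgue {0<..} f \<and>
              (\<integral>\<^sup>+ x. indicator {0<..} x * ennreal ((cmod (f x) * x powr (c - 1/2))\<^sup>2) \<partial>lebesgue) < \<infinity>}"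

definition mellin_trunc :: "real \<Rightarrow> (real \<Rightarrow> complex) \<Rightarrow> real \<Rightarrow> real \<Rightarrow> complex" where
  "mellin_trunc c f \<rho> t =
     set_lebesgue_integral lebesgue {1/\<rho>..\<rho>}
       (\<lambda>u. f u * (complex_of_real u) powr (complex_of_real c + \<i> * complex_of_real t - 1))"

definition is_mellin_L2 :: "real \<Rightarrow> (real \<Rightarrow> complex) \<Rightarrow> (real \<Rightarrow> complex) \<Rightarrow> bool" where
  "is_mellin_L2 c f F \<longleftrightarrow>
     F \<in> borel_measurable lebesgue \<and>
     (\<integral>\<^sup>+ t. ennreal ((cmod (F t))\<^sup>2) \<partial>lebesgue) < \<infinity> \<and>
     ((\<lambda>\<rho>. \<integral>\<^sup>+ t. ennreal ((cmod (mellin_trunc c f \<rho> t - F t))\<^sup>2) \<partial>lebesgue) \<longlongrightarrow> 0) at_top"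

definition B2 :: "real \<Rightarrow> real \<Rightarrow> (real \<Rightarrow> complex) set" where
  "B2 c T = {f. f \<in> X2 c \<and> continuous_on {0<..} f \<and>
               (\<exists>F. is_mellin_L2 c f F \<and> (AE t in lebesgue. \<bar>t\<bar> > T \<longrightarrow> F t = 0))}"

definition Omega :: "complex set" where
  "Omega = - {z. Im z = 0 \<and> Re z \<ge> 0}"

definition bplus :: "(int \<Rightarrow> complex \<Rightarrow> complex) \<Rightarrow> int \<Rightarrow> real \<Rightarrow> complex" where
  "bplus G k x = Lim (at_right 0) (\<lambda>\<epsilon>::real. G k (complex_of_real x + \<i> * complex_of_real \<epsilon>))"

definition bminus :: "(int \<Rightarrow> complex \<Rightarrow> complex) \<Rightarrow> int \<Rightarrow> real \<Rightarrow> complex" where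
  "bminus G k x = Lim (at_right 0) (\<lambda>\<epsilon>::real. G k (complex_of_real x - \<i> * complex_of_real \<epsilon>))"

definition gpolar :: "(int \<Rightarrow> complex \<Rightarrow> complex) \<Rightarrow> int \<Rightarrow> real \<Rightarrow> real \<Rightarrow> complex" where
  "gpolar G k r \<theta> =
     (if \<theta> = 0 then bplus G k r
      else if \<theta> = 2 * pi then bminus G k r
      else G k (complex_of_real r * exp (\<i> * complex_of_real \<theta>)))"

definition psi :: "(int \<Rightarrow> complex \<Rightarrow> complex) \<Rightarrow> int \<Rightarrow> complex \<Rightarrow> complex" where
  "psi G k z = (if Im z < 0 then G k z
                else if Im z = 0 then bminus G k (Re z)
                else G (k + 1) z)"

definition MB2 :: "real \<Rightarrow> real \<Rightarrow> (real \<Rightarrow> complex) set" where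
  "MB2 c T = {f. f \<in> X2 c \<and>
     (\<exists>G :: int \<Rightarrow> complex \<Rightarrow> complex.
        (\<forall>k. G k analytic_on Omega) \<and>
        \<comment> \<open>(i)\<close>
        (\<forall>k. \<forall>x>0.
            (\<exists>l. ((\<lambda>\<epsilon>::real. G k (complex_of_real x + \<i> * complex_of_real \<epsilon>)) \<longlongrightarrow> l) (at_right 0)) \<and>
            (\<exists>l. ((\<lambda>\<epsilon>::real. G k (complex_of_real x - \<i> * complex_of_real \<epsilon>)) \<longlongrightarrow> l) (at_right 0)) \<and>
            bminus G k x = bplus G (k + 1) x) \<and>
        (\<forall>x>0. bplus G 0 x = complex_of_real (x powr c) * f x) \<and>
        \<comment> \<open>(ii)\<close>
        (\<forall>k. \<forall>x>0. \<forall>\<rho>>0. ball (complex_of_real x) \<rho> \<subseteq> {z. Re z > 0} \<longrightarrow>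
            psi G k analytic_on ball (complex_of_real x) \<rho>) \<and>
        \<comment> \<open>(iii)\<close>
        (\<exists>C>0. \<forall>k r \<theta>. r > 0 \<and> 0 \<le> \<theta> \<and> \<theta> \<le> 2 * pi \<longrightarrow>
            cmod (gpolar G k r \<theta>) \<le> C * exp (T * \<bar>2 * pi * of_int k + \<theta>\<bar>)) \<and>
        \<comment> \<open>(iv)\<close>
        (\<forall>k. uniform_limit {0..2*pi} (\<lambda>r \<theta>. gpolar G k r \<theta>) (\<lambda>_. 0) (at_right 0) \<and>
             uniform_limit {0..2*pi} (\<lambda>r \<theta>. gpolar G k r \<theta>) (\<lambda>_. 0) at_top))}"

end

theory Submission
  imports Defs "HOL-Probability.Probability" "HOL-Real_Asymp.Real_Asymp"
begin

text \<open>
  Under \<open>x = exp y\<close> the Mellin transform on the line \<open>Re s = c\<close> becomes the Fourier transform of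
  \<open>h y = exp (c y) f (exp y)\<close>, and a function on the Riemann surface of the logarithm with branches
  \<open>g\<^sub>k\<close> becomes a single entire function \<open>H\<close> extending \<open>h\<close>, with
  \<open>g\<^sub>k (r exp (i \<theta>)) = H (ln r + i (2 \<pi> k + \<theta>))\<close>; condition (iii) says that
  \<open>\<bar>H z\<bar> \<le> C exp (T \<bar>Im z\<bar>)\<close>. So the theorem is the classical Paley--Wiener theorem.

  From branches to band limitation: the truncated Fourier integrals of \<open>h\<close> converge in \<open>L\<^sup>2\<close>
  (Bessel's inequality and completeness), hence almost everywhere along a subsequence. For \<open>t > T\<close>,
  closing \<open>[-R, R]\<close> by the three other sides of the rectangle of height \<open>R\<close> shows that these integrals
  tend to 0 pointwise, because \<open>H\<close> vanishes at infinity on horizontal lines.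

  From band limitation to branches: the spectrum \<open>F\<close> is integrable, so
  \<open>H w = (\<integral> F t exp (- i t w) dt) / (2 \<pi>)\<close> is entire and of the required growth. It agrees with
  \<open>h\<close> by Gaussian summation, and it decays in horizontal strips since any locally uniform limit
  of translates of \<open>H\<close> (Montel) vanishes on \<open>[0, 1]\<close>, as \<open>h\<close> is in \<open>L\<^sup>2\<close>.
\<close>

subsection \<open>Gaussian summation and Bessel's inequality\<close>

text \<open>Since \<open>h\<close> is only square integrable, its truncated Fourier integrals may
  fail to converge at a given point, and the transform exists only as an \<open>L2\<close> limit,
  determined up to null sets. Band limitation therefore compares two limits of one family, the
  pointwise one and the \<open>L2\<close> one, and a subsequence converging almost everywhere forces
  them to agree. For the \<open>L2\<close> limit to exist, only an upper estimate of the norm of a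
  transform is required, which is why Bessel's inequality stands where Plancherel's identity might
  be expected. In the other direction the obstacle is that \<open>h x\<close> must equal the
  inversion integral at every \<open>x\<close>, not just at almost every \<open>x\<close>;
  continuity of \<open>h\<close> supplies this. Gaussians suit both tasks: \<open>gauss s\<close>
  tends to 1 as \<open>s\<close> tends to 0, while its transform concentrates at the origin with
  constant mass \<open>2 * pi\<close>.\<close>

definition gauss :: "real \<Rightarrow> real \<Rightarrow> real" where
  "gauss s x = exp (- ((s * x)\<^sup>2) / 2)"

text \<open>The sign of the exponent is that of \<open>u powr (\<i> * t)\<close> at
  \<open>u = exp y\<close>, and there is no normalising factor, so that truncated Mellin integrals
  become values of \<open>fourier\<close> exactly. The price is a factor \<open>2 * pi\<close> in
  Bessel's inequality and in the inversion formula.\<close>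

definition fourier :: "(real \<Rightarrow> complex) \<Rightarrow> real \<Rightarrow> complex" where
  "fourier k t = (LBINT y. k y * iexp (t * y))"

lemma gauss_nonneg [simp]: "0 \<le> gauss s x" and gauss_le_1: "gauss s x \<le> 1"
  by (auto simp: gauss_def)

lemma gauss_measurable [measurable]: "gauss s \<in> borel_measurable borel"
  by (simp add: gauss_def [abs_def])

lemma iexp_measurable [measurable]: "iexp \<in> borel_measurable borel"
  by (intro borel_measurable_continuous_onI continuous_intros)

lemma cnj_measurable [measurable]: "cnj \<in> borel_measurable borel"
  by (intro borel_measurable_continuous_onI continuous_intros)

lemma gauss_eq: "gauss s x = sqrt (2 * pi) * std_normal_density (s * x)"
  by (simp add: gauss_def std_normal_density_def)

lemma has_bochner_integral_gauss:
  assumes "s > 0"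
  shows "has_bochner_integral lborel (gauss s) (sqrt (2 * pi) / s)"
proof -
  have 1: "has_bochner_integral lborel std_normal_density 1"
    using prob_space.prob_space[OF prob_space_normal_density[of 1 0]]
      integrable_normal_density[of 1 0] integral_normal_density[of 1 0] by (simp add: has_bochner_integral_iff)
  have "integrable lborel (\<lambda>x. std_normal_density (0 + s * x))"
    using 1 assms by (intro lborel_integrable_real_affine) (auto simp: has_bochner_integral_iff)
  moreover have "(LBINT x. std_normal_density (0 + s * x)) = 1 / s"
    using lborel_integral_real_affine[of s std_normal_density 0] 1 assms
    by (simp add: has_bochner_integral_iff field_simps)
  ultimately show ?thesis
    by (simp add: has_bochner_integral_iff gauss_eq [abs_def])
qed

lemma gauss_integrable: "s > 0 \<Longrightarrow> integrable lborel (gauss s)"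
  using has_bochner_integral_gauss by (auto simp: has_bochner_integral_iff)

lemma nn_integral_gauss:
  assumes "s > 0" shows "(\<integral>\<^sup>+x. gauss s (a + x) \<partial>lborel) = sqrt (2 * pi) / s"
proof -
  have "(\<integral>\<^sup>+x. gauss s (a + x) \<partial>lborel) = (\<integral>\<^sup>+x. gauss s x \<partial>lborel)"
    by (subst nn_integral_real_affine[of "\<lambda>x. gauss s x" 1 a]) auto
  also have "\<dots> = sqrt (2 * pi) / s"
    using has_bochner_integral_gauss[OF assms] assms by (subst nn_integral_eq_integral) (auto simp: has_bochner_integral_iff)
  finally show ?thesis .
qed

text \<open>This is the characteristic function of the standard normal law after rescaling by
  \<open>s\<close>. Width \<open>1 / s\<close> turns into width \<open>s\<close>, so a factor that
  flattens to 1 has a transform that concentrates at 0.\<close>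

lemma fourier_gauss:
  assumes "s > 0"
  shows "fourier (\<lambda>x. gauss s x) t = sqrt (2 * pi) / s * gauss (1 / s) t"
proof -
  have "gauss (1 / s) t = char std_normal_distribution (t / s)"
    by (simp add: char_std_normal_distribution gauss_def power_divide)
  also have "\<dots> = (CLINT x|lborel. std_normal_density x * iexp (t / s * x))"
    by (subst char_def, subst integral_density) (auto simp: scaleR_conv_of_real)
  also have "\<dots> = s * (CLINT x|lborel. std_normal_density (0 + s * x) * iexp (t / s * (0 + s * x)))"
    using assms by (subst lborel_integral_real_affine[of s _ 0]) (auto simp: scaleR_conv_of_real)
  also have "(CLINT x|lborel. std_normal_density (0 + s * x) * iexp (t / s * (0 + s * x)))
     = (CLINT x|lborel. (1 / sqrt (2 * pi)) * (gauss s x * iexp (t * x)))"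
    using assms by (intro Bochner_Integration.integral_cong) (auto simp: gauss_eq)
  also have "\<dots> = (1 / sqrt (2 * pi)) * fourier (\<lambda>x. gauss s x) t"
    by (simp add: fourier_def)
  finally show ?thesis using assms by (simp add: field_simps)
qed

lemma fourier_measurable [measurable]:
  assumes [measurable]: "k \<in> borel_measurable lborel"
  shows "fourier k \<in> borel_measurable lborel"
  unfolding fourier_def [abs_def] by measurable

lemma integrable_mult_bounded:
  fixes f g :: "'a \<Rightarrow> complex"
  assumes "integrable M f" and [measurable]: "g \<in> borel_measurable M" and "\<And>x. cmod (g x) \<le> B"
  shows "integrable M (\<lambda>x. f x * g x)" "integrable M (\<lambda>x. g x * f x)"
proof -
  have [measurable]: "f \<in> borel_measurable M" using assms by auto
  show "integrable M (\<lambda>x. f x * g x)"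
  proof (rule Bochner_Integration.integrable_bound)
    show "integrable M (\<lambda>x. B * norm (f x))" using assms by auto
    show "AE x in M. norm (f x * g x) \<le> norm (B * norm (f x))"
    proof (rule AE_I2)
      fix x
      have "cmod (f x) * cmod (g x) \<le> cmod (f x) * \<bar>B\<bar>"
        using assms(3)[of x] by (intro mult_left_mono) auto
      then show "norm (f x * g x) \<le> norm (B * norm (f x))"
        by (simp add: norm_mult abs_mult mult.commute)
    qed
  qed auto
  then show "integrable M (\<lambda>x. g x * f x)" by (simp add: mult.commute)
qed

lemma norm_fourier_le:
  shows "cmod (fourier k t) \<le> (LBINT y. cmod (k y))"
  unfolding fourier_def by (rule order_trans[OF integral_norm_bound]) (simp add: norm_mult)

text \<open>Fubini for \<open>k y * iexp (t * y) * g t\<close>, whose modulus is a product of two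
  integrable functions. It does the work of Parseval's identity: transforms are only ever tested
  against integrable functions.\<close>

lemma fourier_mult_formula:
  assumes k: "integrable lborel k" and g: "integrable lborel g"
  shows "(LBINT t. fourier k t * g t) = (LBINT y. k y * fourier g y)"
proof -
  have [measurable]: "k \<in> borel_measurable borel" "g \<in> borel_measurable borel" using k g by auto
  have "integrable (lborel \<Otimes>\<^sub>M lborel) (\<lambda>(y, t). k y * iexp (t * y) * g t)"
  proof (rule lborel_pair.Fubini_integrable)
    have "integrable lborel (\<lambda>y. cmod (k y) * (LBINT t. cmod (g t)))"
      using k by auto
    then show "integrable lborel (\<lambda>x. LBINT y. cmod (case (x, y) of (y, t) \<Rightarrow> k y * iexp (t * y) * g t))"
      by (simp add: norm_mult)
    show "AE x in lborel. integrable lborel (\<lambda>y. case (x, y) of (y, t) \<Rightarrow> k y * iexp (t * y) * g t)"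
      by (auto intro!: AE_I2 integrable_mult_bounded(2)[OF g, where B="cmod (k _)"] simp: norm_mult)
  qed measurable
  from lborel_pair.Fubini_integral[OF this]
  show ?thesis by (simp add: fourier_def mult_ac flip: integral_mult_left_zero integral_mult_right_zero)
qed

lemma fourier_cnj: "cnj (fourier k t) = fourier (\<lambda>y. cnj (k (- y))) t"
proof -
  have "cnj (fourier k t) = (LBINT y. cnj (k y) * iexp (- t * y))"
    unfolding fourier_def by (subst Bochner_Integration.integral_cnj[symmetric]) (simp add: exp_cnj)
  also have "\<dots> = fourier (\<lambda>y. cnj (k (- y))) t"
    by (subst lborel_integral_real_affine[of "-1" _ 0]) (auto simp: fourier_def)
  finally show ?thesis .
qed

text \<open>Multiplying a Gaussian by \<open>iexp (y * t)\<close> translates its transform by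
  \<open>y\<close>, so transforming the damped transform gives a Gaussian average of
  \<open>k\<close>. The sum \<open>x + y\<close> in place of a difference reflects that applying
  \<open>fourier\<close> twice reverses the argument.\<close>

lemma fourier_mult_gauss:
  assumes "integrable lborel k" "s > 0"
  shows "fourier (\<lambda>t. fourier k t * gauss s t) y
         = (LBINT x. k x * (sqrt (2 * pi) / s * gauss (1 / s) (x + y)))"
proof -
  have "fourier (\<lambda>t. fourier k t * gauss s t) y = (LBINT t. fourier k t * (gauss s t * iexp (y * t)))"
    by (simp add: fourier_def mult_ac)
  also have "\<dots> = (LBINT x. k x * fourier (\<lambda>t. gauss s t * iexp (y * t)) x)"
    by (rule fourier_mult_formula[OF assms(1)], rule integrable_mult_bounded(1)[where B = 1])
       (use gauss_integrable[OF assms(2)] in auto)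
  also have "(\<lambda>x. fourier (\<lambda>t. gauss s t * iexp (y * t)) x) = (\<lambda>x. fourier (\<lambda>t. gauss s t) (x + y))"
    by (simp add: fourier_def mult_ac ring_distribs exp_add fun_eq_iff)
  finally show ?thesis
    by (simp add: fourier_gauss[OF assms(2)] flip: of_real_mult of_real_divide)
qed

text \<open>\<open>fourier k\<close> is merely known to be bounded; the Gaussian factor makes the
  integral of its square converge. The estimate is a Schur test with the kernel
  \<open>G (x + y)\<close>, whose mass in each variable is \<open>2 * pi\<close> for every
  \<open>s\<close>, whence a constant free of \<open>s\<close>.\<close>

lemma fourier_Bessel_gauss:
  assumes k: "integrable lborel k" and s: "s > 0"
  shows "(\<integral>\<^sup>+t. ennreal ((cmod (fourier k t))\<^sup>2 * gauss s t) \<partial>lborel)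
          \<le> 2 * pi * (\<integral>\<^sup>+y. ennreal ((cmod (k y))\<^sup>2) \<partial>lborel)"
proof -
  have [measurable]: "k \<in> borel_measurable borel" using k by auto
  define G where "G = (\<lambda>x. sqrt (2 * pi) / s * gauss (1 / s) x)"
  \<comment> \<open>The transform of \<open>k'\<close> is the conjugate of that of \<open>k\<close>, so applying the multiplication formula
    to \<open>k\<close> and then to \<open>k'\<close> turns the integral into a double integral against the Gaussian \<open>G\<close>.\<close>
  define k' where "k' = (\<lambda>y. cnj (k (- y)))"
  have [measurable]: "G \<in> borel_measurable borel" "k' \<in> borel_measurable borel"
    unfolding G_def k'_def by (measurable; fail)+
  have G0: "G x \<ge> 0" for x using s by (simp add: G_def)
  have G_bd: "G x \<le> sqrt (2 * pi) / s" for x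
    unfolding G_def using s gauss_le_1 by (intro mult_left_le) auto
  have G_int: "(\<integral>\<^sup>+x. ennreal (G (a + x)) \<partial>lborel) = ennreal (2 * pi)" for a
  proof -
    have "(\<integral>\<^sup>+x. ennreal (G (a + x)) \<partial>lborel)
        = ennreal (sqrt (2 * pi) / s) * (\<integral>\<^sup>+x. ennreal (gauss (1 / s) (a + x)) \<partial>lborel)"
      unfolding G_def using s by (subst nn_integral_cmult[symmetric]) (auto simp: mult_ac simp flip: ennreal_mult)
    also have "\<dots> = ennreal (sqrt (2 * pi) / s) * ennreal (sqrt (2 * pi) / (1 / s))"
      using s by (subst nn_integral_gauss) auto
    also have "\<dots> = ennreal (2 * pi)"
      using s by (simp flip: ennreal_mult)
    finally show ?thesis .
  qed
  have k': "integrable lborel k'"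
    using lborel_integrable_real_affine[OF k, of "-1" 0] by (simp add: k'_def)
  define B where "B = (LBINT y. cmod (k y))"
  have bnd: "cmod (fourier k t) \<le> B" for t unfolding B_def by (rule norm_fourier_le)
  have int1: "integrable lborel (\<lambda>t. fourier k' t * gauss s t)"
    by (rule integrable_mult_bounded(2)[where B = B])
       (use gauss_integrable[OF s] bnd in \<open>auto simp: k'_def simp flip: fourier_cnj\<close>)
  have int2: "integrable lborel (\<lambda>t. fourier k t * (fourier k' t * gauss s t))"
    by (rule integrable_mult_bounded(2)[OF int1]) (use bnd in auto)
  have eq: "fourier k t * (fourier k' t * gauss s t) = of_real ((cmod (fourier k t))\<^sup>2 * gauss s t)" for t
    by (simp add: k'_def complex_norm_square[symmetric] mult.assoc[symmetric] flip: fourier_cnj)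
  define A where "A = (\<integral>\<^sup>+y. ennreal ((cmod (k y))\<^sup>2) \<partial>lborel)"
  have A': "(\<integral>\<^sup>+y. ennreal ((cmod (k' y))\<^sup>2) \<partial>lborel) = A"
    unfolding A_def k'_def by (subst nn_integral_real_affine[of _ "-1" 0]) auto
  have int3: "integrable lborel (\<lambda>t. (cmod (fourier k t))\<^sup>2 * gauss s t)"
    using int2 unfolding eq by (simp only: complex_of_real_integrable_eq)
  have "(\<integral>\<^sup>+t. ennreal ((cmod (fourier k t))\<^sup>2 * gauss s t) \<partial>lborel)
     = ennreal (LBINT t. (cmod (fourier k t))\<^sup>2 * gauss s t)"
    by (rule nn_integral_eq_integral[OF int3]) auto
  also have "(LBINT t. (cmod (fourier k t))\<^sup>2 * gauss s t)
     = cmod (LBINT t. fourier k t * (fourier k' t * gauss s t))"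
    unfolding eq integral_complex_of_real by simp
  also have "(LBINT t. fourier k t * (fourier k' t * gauss s t))
     = (LBINT y. k y * (LBINT x. k' x * G (x + y)))"
    unfolding fourier_mult_formula[OF k int1] fourier_mult_gauss[OF k' s] G_def ..
  finally have step1: "(\<integral>\<^sup>+t. ennreal ((cmod (fourier k t))\<^sup>2 * gauss s t) \<partial>lborel)
     = ennreal (cmod (LBINT y. k y * (LBINT x. k' x * G (x + y))))" .
  have half: "(\<integral>\<^sup>+y. \<integral>\<^sup>+x. ennreal ((cmod (q y))\<^sup>2 / 2 * G (y + x)) \<partial>lborel \<partial>lborel)
      = ennreal pi * (\<integral>\<^sup>+y. ennreal ((cmod (q y))\<^sup>2) \<partial>lborel)"
    if [measurable]: "q \<in> borel_measurable borel" for q :: "real \<Rightarrow> complex"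
  proof -
    have "(\<integral>\<^sup>+x. ennreal ((cmod (q y))\<^sup>2 / 2 * G (y + x)) \<partial>lborel) = ennreal pi * ennreal ((cmod (q y))\<^sup>2)" for y
    proof -
      have "(\<integral>\<^sup>+x. ennreal ((cmod (q y))\<^sup>2 / 2 * G (y + x)) \<partial>lborel)
          = ennreal ((cmod (q y))\<^sup>2 / 2) * (\<integral>\<^sup>+x. ennreal (G (y + x)) \<partial>lborel)"
        using G0 by (subst nn_integral_cmult[symmetric]) (auto simp flip: ennreal_mult)
      also have "\<dots> = ennreal ((cmod (q y))\<^sup>2 / 2 * (2 * pi))"
        unfolding G_int by (rule ennreal_mult[symmetric]) auto
      also have "\<dots> = ennreal pi * ennreal ((cmod (q y))\<^sup>2)"
        by (subst ennreal_mult[symmetric]) (auto simp: mult.commute)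
      finally show ?thesis .
    qed
    then show ?thesis by (simp add: nn_integral_cmult)
  qed
  define D where "D = (LBINT t. cmod (fourier k' t * gauss s t))"
  have conv: "(LBINT x. k' x * G (x + y)) = fourier (\<lambda>t. fourier k' t * gauss s t) y" for y
    unfolding fourier_mult_gauss[OF k' s] G_def ..
  have int4: "integrable lborel (\<lambda>x. k' x * G (x + y))" for y
    by (rule integrable_mult_bounded(1)[OF k', where B = "sqrt (2 * pi) / s"])
       (use G0 G_bd in auto)
  note step1
  also have "ennreal (cmod (LBINT y. k y * (LBINT x. k' x * G (x + y))))
     \<le> (\<integral>\<^sup>+y. ennreal (cmod (k y * (LBINT x. k' x * G (x + y)))) \<partial>lborel)"
    unfolding conv
    by (intro integral_norm_bound_ennreal integrable_mult_bounded(1)[OF k, where B = D])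
       (use norm_fourier_le in \<open>auto simp: D_def\<close>)
  also have "\<dots> \<le> (\<integral>\<^sup>+y. \<integral>\<^sup>+x. ennreal (cmod (k y) * cmod (k' x) * G (x + y)) \<partial>lborel \<partial>lborel)"
  proof (rule nn_integral_mono)
    fix y
    have "ennreal (cmod (k y * (LBINT x. k' x * G (x + y))))
        = ennreal (cmod (k y)) * ennreal (cmod (LBINT x. k' x * G (x + y)))"
      by (simp add: norm_mult ennreal_mult)
    also have "\<dots> \<le> ennreal (cmod (k y)) * (\<integral>\<^sup>+x. ennreal (cmod (k' x * G (x + y))) \<partial>lborel)"
      by (intro mult_left_mono integral_norm_bound_ennreal int4) auto
    also have "\<dots> = (\<integral>\<^sup>+x. ennreal (cmod (k y) * cmod (k' x) * G (x + y)) \<partial>lborel)"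
      using G0 by (simp add: norm_mult ennreal_mult mult.assoc nn_integral_cmult)
    finally show "ennreal (cmod (k y * (LBINT x. k' x * G (x + y))))
        \<le> (\<integral>\<^sup>+x. ennreal (cmod (k y) * cmod (k' x) * G (x + y)) \<partial>lborel)" .
  qed
  \<comment> \<open>The arithmetic-geometric mean inequality uncouples \<open>k y\<close> from
    \<open>k' x\<close>. In each summand the kernel can then be integrated out over the other
    variable, which leaves \<open>pi\<close> times a squared norm.\<close>
  also have "\<dots> \<le> (\<integral>\<^sup>+y. \<integral>\<^sup>+x. ennreal ((cmod (k y))\<^sup>2 / 2 * G (x + y)) + ennreal ((cmod (k' x))\<^sup>2 / 2 * G (x + y)) \<partial>lborel \<partial>lborel)"
  proof (intro nn_integral_mono)
    fix x y
    have "cmod (k y) * cmod (k' x) \<le> (cmod (k y))\<^sup>2 / 2 + (cmod (k' x))\<^sup>2 / 2"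
      using sum_squares_bound[of "cmod (k y)" "cmod (k' x)"] by simp
    from mult_right_mono[OF this G0]
    show "ennreal (cmod (k y) * cmod (k' x) * G (x + y)) \<le> ennreal ((cmod (k y))\<^sup>2 / 2 * G (x + y)) + ennreal ((cmod (k' x))\<^sup>2 / 2 * G (x + y))"
      using G0 by (simp add: ring_distribs ennreal_leI flip: ennreal_plus)
  qed
  also have "\<dots> = (\<integral>\<^sup>+y. \<integral>\<^sup>+x. ennreal ((cmod (k y))\<^sup>2 / 2 * G (y + x)) \<partial>lborel \<partial>lborel)
       + (\<integral>\<^sup>+x. \<integral>\<^sup>+y. ennreal ((cmod (k' x))\<^sup>2 / 2 * G (x + y)) \<partial>lborel \<partial>lborel)"
    by (subst (2) lborel_pair.Fubini'[symmetric])
       (auto simp: nn_integral_add add.commute)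
  also have "\<dots> = ennreal pi * A + ennreal pi * A"
    by (subst (1 2) half) (simp_all add: A' flip: A_def)
  also have "\<dots> = 2 * pi * A"
    by (simp only: distrib_right[symmetric] ennreal_plus[symmetric] pi_ge_zero mult_2)
  finally show ?thesis unfolding A_def .
qed

text \<open>The damped estimate is uniform in \<open>s\<close>, so Fatou's lemma along
  \<open>s = 1 / Suc n\<close> removes the damping.\<close>

lemma fourier_Bessel:
  assumes k: "integrable lborel k"
  shows "(\<integral>\<^sup>+t. ennreal ((cmod (fourier k t))\<^sup>2) \<partial>lborel)
          \<le> 2 * pi * (\<integral>\<^sup>+y. ennreal ((cmod (k y))\<^sup>2) \<partial>lborel)" (is "_ \<le> ?R")
proof -
  have [measurable]: "k \<in> borel_measurable borel" using k by auto
  define u where "u = (\<lambda>n t. ennreal ((cmod (fourier k t))\<^sup>2 * gauss (1 / real (Suc n)) t))"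
  have "(\<lambda>n. u n t) \<longlonglongrightarrow> ennreal ((cmod (fourier k t))\<^sup>2)" for t
  proof -
    have "(\<lambda>n. (cmod (fourier k t))\<^sup>2 * gauss (1 / real (Suc n)) t) \<longlonglongrightarrow> (cmod (fourier k t))\<^sup>2 * exp (- (0 * t)\<^sup>2 / 2)"
      unfolding gauss_def by (intro tendsto_intros LIMSEQ_Suc[OF lim_1_over_n]) auto
    then show ?thesis unfolding u_def by (intro tendsto_ennrealI) auto
  qed
  then have "(\<integral>\<^sup>+t. ennreal ((cmod (fourier k t))\<^sup>2) \<partial>lborel) = (\<integral>\<^sup>+t. liminf (\<lambda>n. u n t) \<partial>lborel)"
    by (intro nn_integral_cong) (metis lim_imp_Liminf sequentially_bot)
  also have "\<dots> \<le> liminf (\<lambda>n. \<integral>\<^sup>+t. u n t \<partial>lborel)"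
    by (rule nn_integral_liminf) (auto simp: u_def)
  also have "\<dots> \<le> ?R"
    by (rule Liminf_le) (auto simp: u_def intro!: fourier_Bessel_gauss[OF k] always_eventually)
  finally show ?thesis .
qed

subsection \<open>Completeness of \<open>L\<^sup>2\<close>\<close>

text \<open>The Riesz-Fischer argument, with the almost everywhere convergent subsequence delivered
  along with the \<open>L2\<close> limit, since pointwise information about \<open>u n\<close> has
  to be carried over to \<open>F\<close>.\<close>

lemma L2_complete:
  fixes u :: "nat \<Rightarrow> 'a \<Rightarrow> complex"
  assumes [measurable]: "\<And>n. u n \<in> borel_measurable M"
    and Cauchy: "\<And>e::real. e > 0 \<Longrightarrow> \<exists>N. \<forall>m\<ge>N. \<forall>n\<ge>N. (\<integral>\<^sup>+t. ennreal ((cmod (u m t - u n t))\<^sup>2) \<partial>M) \<le> e"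
  obtains F r where "F \<in> borel_measurable M" "strict_mono (r :: nat \<Rightarrow> nat)"
    "AE t in M. (\<lambda>n. u (r n) t) \<longlonglongrightarrow> F t"
    "(\<lambda>n. \<integral>\<^sup>+t. ennreal ((cmod (u n t - F t))\<^sup>2) \<partial>M) \<longlonglongrightarrow> 0"
proof -
  define I where "I = (\<lambda>m n. \<integral>\<^sup>+t. ennreal ((cmod (u m t - u n t))\<^sup>2) \<partial>M)"
  have "\<forall>k. \<exists>N. \<forall>m\<ge>N. \<forall>n\<ge>N. I m n \<le> ennreal ((1/4)^k)"
    using Cauchy by (auto simp: I_def simp del: ennreal_power)
  then obtain N where N: "\<And>k m n. m \<ge> N k \<Longrightarrow> n \<ge> N k \<Longrightarrow> I m n \<le> ennreal ((1/4)^k)"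
    by metis
  define r where "r = (\<lambda>k. k + (\<Sum>i\<le>k. N i))"
  have "strict_mono r" by (rule strict_monoI_Suc) (simp add: r_def)
  have rN: "r k \<ge> N k" for k
  proof -
    have "N k \<le> (\<Sum>i\<le>k. N i)" by (rule member_le_sum) auto
    then show ?thesis unfolding r_def by simp
  qed
  have rS: "r (Suc k) \<ge> N k" for k
    using rN[of k] strict_monoD[OF \<open>strict_mono r\<close>, of k "Suc k"] by simp
  \<comment> \<open>The squared distance of consecutive terms is at most \<open>(1/4)^k\<close>. The
    weight \<open>2^k\<close> still leaves the summable \<open>(1/2)^k\<close>, and wherever the
    weighted sum is finite, \<open>cmod (d k t)\<close> is eventually at most
    \<open>sqrt (1/2) ^ k\<close>. So pointwise convergence follows by comparison with a geometric
    series, without a triangle inequality in \<open>L2\<close>.\<close>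
  define d where "d = (\<lambda>k t. u (r (Suc k)) t - u (r k) t)"
  have [measurable]: "d k \<in> borel_measurable M" for k unfolding d_def by measurable
  have "(\<integral>\<^sup>+t. (\<Sum>k. ennreal (2^k * (cmod (d k t))\<^sup>2)) \<partial>M) = (\<Sum>k. \<integral>\<^sup>+t. ennreal (2^k * (cmod (d k t))\<^sup>2) \<partial>M)"
    by (rule nn_integral_suminf) auto
  also have "\<dots> \<le> (\<Sum>k. ennreal ((1/2)^k))"
  proof (intro suminf_le)
    fix k
    have "(\<integral>\<^sup>+t. ennreal (2^k * (cmod (d k t))\<^sup>2) \<partial>M) = ennreal (2^k) * I (r (Suc k)) (r k)"
      unfolding I_def d_def by (simp add: ennreal_mult nn_integral_cmult del: ennreal_power)
    also have "\<dots> \<le> ennreal (2^k) * ennreal ((1/4)^k)"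
      by (intro mult_left_mono N rS rN) auto
    also have "\<dots> = ennreal ((1/2)^k)"
      by (simp add: power_mult_distrib[symmetric] del: ennreal_power flip: ennreal_mult)
    finally show "(\<integral>\<^sup>+t. ennreal (2^k * (cmod (d k t))\<^sup>2) \<partial>M) \<le> ennreal ((1/2)^k)" .
  qed auto
  also have "\<dots> < \<infinity>"
    by (subst suminf_ennreal2) (auto simp del: ennreal_power)
  finally have "AE t in M. (\<Sum>k. ennreal (2^k * (cmod (d k t))\<^sup>2)) \<noteq> \<infinity>"
    by (intro nn_integral_PInf_AE) auto
  then have conv: "AE t in M. convergent (\<lambda>n. u (r n) t)"
  proof eventually_elim
    fix t assume "(\<Sum>k. ennreal (2^k * (cmod (d k t))\<^sup>2)) \<noteq> \<infinity>"
    then have "summable (\<lambda>k. 2^k * (cmod (d k t))\<^sup>2)"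
      by (intro summable_suminf_not_top) auto
    then have "(\<lambda>k. 2^k * (cmod (d k t))\<^sup>2) \<longlonglongrightarrow> 0" by (rule summable_LIMSEQ_zero)
    then have "eventually (\<lambda>k. 2^k * (cmod (d k t))\<^sup>2 < 1) sequentially"
      by (rule order_tendstoD) simp
    then have "eventually (\<lambda>k. norm (d k t) \<le> (sqrt (1/2))^k) sequentially"
    proof eventually_elim
      fix k assume "2^k * (cmod (d k t))\<^sup>2 < 1"
      then have "(cmod (d k t))\<^sup>2 \<le> (1/2)^k" by (simp add: field_simps power_divide)
      then have "cmod (d k t) \<le> sqrt ((1/2)^k)" by (rule real_le_rsqrt)
      then show "norm (d k t) \<le> (sqrt (1/2))^k" by (simp add: real_sqrt_power)
    qed
    then have "summable (\<lambda>k. d k t)"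
      by (rule summable_comparison_test_ev) (auto intro!: summable_geometric simp: real_sqrt_divide)
    then have "convergent (\<lambda>n. \<Sum>k<n. d k t)" by (simp add: summable_iff_convergent)
    then have "convergent (\<lambda>n. (\<Sum>k<n. d k t) + u (r 0) t)"
      by (intro convergent_add convergent_const)
    also have "(\<lambda>n. (\<Sum>k<n. d k t) + u (r 0) t) = (\<lambda>n. u (r n) t)"
      unfolding d_def by (subst sum_lessThan_telescope) simp
    finally show "convergent (\<lambda>n. u (r n) t)" .
  qed
  define F where "F = (\<lambda>t. lim (\<lambda>n. u (r n) t))"
  have [measurable]: "F \<in> borel_measurable M"
    unfolding F_def by measurable
  have lim: "AE t in M. (\<lambda>n. u (r n) t) \<longlonglongrightarrow> F t"
    using conv by eventually_elim (simp add: F_def convergent_LIMSEQ_iff)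
  \<comment> \<open>Fatou's lemma along the subsequence turns the Cauchy estimate between
    \<open>u m\<close> and \<open>u (r n)\<close> into one between \<open>u m\<close> and
    \<open>F\<close>.\<close>
  have bound: "(\<integral>\<^sup>+t. ennreal ((cmod (u m t - F t))\<^sup>2) \<partial>M) \<le> ennreal ((1/4)^k)" if "m \<ge> N k" for m k
  proof -
    have "(\<integral>\<^sup>+t. ennreal ((cmod (u m t - F t))\<^sup>2) \<partial>M) =
          (\<integral>\<^sup>+t. liminf (\<lambda>n. ennreal ((cmod (u m t - u (r n) t))\<^sup>2)) \<partial>M)"
    proof (rule nn_integral_cong_AE, use lim in eventually_elim)
      fix t assume "(\<lambda>n. u (r n) t) \<longlonglongrightarrow> F t"
      then have "(\<lambda>n. ennreal ((cmod (u m t - u (r n) t))\<^sup>2)) \<longlonglongrightarrow> ennreal ((cmod (u m t - F t))\<^sup>2)"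
        by (intro tendsto_intros tendsto_ennrealI)
      then show "ennreal ((cmod (u m t - F t))\<^sup>2) = liminf (\<lambda>n. ennreal ((cmod (u m t - u (r n) t))\<^sup>2))"
        by (metis lim_imp_Liminf sequentially_bot)
    qed
    also have "\<dots> \<le> liminf (\<lambda>n. I m (r n))"
      unfolding I_def by (rule nn_integral_liminf) measurable
    also have "\<dots> \<le> ennreal ((1/4)^k)"
    proof (rule Liminf_le)
      show "\<forall>\<^sub>F n in sequentially. I m (r n) \<le> ennreal ((1/4)^k)"
      proof (rule eventually_sequentiallyI)
        fix n assume "k \<le> n"
        then have "r k \<le> r n" using \<open>strict_mono r\<close> by (simp add: strict_mono_less_eq)
        then show "I m (r n) \<le> ennreal ((1/4)^k)"
          using rN[of k] by (intro N that) simp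
      qed
    qed auto
    finally show ?thesis .
  qed
  have "(\<lambda>n. \<integral>\<^sup>+t. ennreal ((cmod (u n t - F t))\<^sup>2) \<partial>M) \<longlonglongrightarrow> 0"
  proof (rule order_tendstoI)
    fix e :: ennreal assume "0 < e"
    have "(\<lambda>k. ennreal ((1/4)^k)) \<longlonglongrightarrow> ennreal 0"
      by (intro tendsto_ennrealI LIMSEQ_realpow_zero) auto
    then have "eventually (\<lambda>k. ennreal ((1/4)^k) < e) sequentially"
      using \<open>0 < e\<close> by (intro order_tendstoD(2)) auto
    then obtain k where "ennreal ((1/4)^k) < e" by (auto simp: eventually_sequentially)
    then show "\<forall>\<^sub>F n in sequentially. (\<integral>\<^sup>+t. ennreal ((cmod (u n t - F t))\<^sup>2) \<partial>M) < e"
      using bound by (intro eventually_sequentiallyI[of "N k"]) (rule le_less_trans)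
  qed auto
  with lim \<open>strict_mono r\<close> \<open>F \<in> borel_measurable M\<close> show ?thesis by (intro that)
qed

subsection \<open>Inversion of the \<open>L\<^sup>2\<close> Fourier transform\<close>

definition truncate :: "real \<Rightarrow> (real \<Rightarrow> complex) \<Rightarrow> real \<Rightarrow> complex" where
  "truncate R h y = indicator {-R..R} y *\<^sub>R h y"

lemma truncate_measurable [measurable]:
  "h \<in> borel_measurable borel \<Longrightarrow> truncate R h \<in> borel_measurable borel"
  unfolding truncate_def [abs_def] by measurable

lemma truncate_integrable:
  assumes "continuous_on UNIV h"
  shows "integrable lborel (truncate R h)"
  using borel_integrable_atLeastAtMost'[OF continuous_on_subset[OF assms], of "-R" R]
  by (simp add: set_integrable_def truncate_def [abs_def])

text \<open>Stands in for Cauchy-Schwarz where a square integrable factor meets a bounded integrable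
  one: it yields an integrable majorant directly.\<close>

lemma norm_le_1_plus_square: "cmod z \<le> 1 + (cmod z)\<^sup>2"
  using sum_squares_bound[of 1 "cmod z"] norm_ge_zero[of z] unfolding power_one mult_1_right by linarith

lemma integrable_square:
  fixes h :: "real \<Rightarrow> complex"
  assumes [measurable]: "h \<in> borel_measurable borel"
    and "(\<integral>\<^sup>+y. ennreal ((cmod (h y))\<^sup>2) \<partial>lborel) < \<infinity>"
  shows "integrable lborel (\<lambda>y. (cmod (h y))\<^sup>2)"
  using assms(2) by (intro integrableI_bounded) auto

text \<open>The exponent \<open>a^2 * y^2 / 2\<close> dominates \<open>a^2 / 4 + y^2 / 4\<close>
  when \<open>a\<close> and \<open>\<bar>y\<bar>\<close> are at least 1. One part absorbs the factor
  \<open>a\<close>, because \<open>a \<le> exp (a^2 / 4)\<close>; the other remains as a majorant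
  independent of \<open>a\<close>. The parameter \<open>1 / sqrt 2\<close> is the one for which
  \<open>gauss\<close> is \<open>exp (- (y^2 / 4))\<close>.\<close>

lemma gauss_tail_bound:
  assumes "a \<ge> 1" "\<bar>y\<bar> \<ge> 1"
  shows "a * gauss a y \<le> gauss (1 / sqrt 2) y"
proof -
  have "1 \<le> y\<^sup>2" "1 \<le> a\<^sup>2" using assms power_mono[of 1 "\<bar>y\<bar>" 2] power_mono[of 1 a 2] by auto
  then have "a\<^sup>2 \<le> a\<^sup>2 * y\<^sup>2" "y\<^sup>2 \<le> a\<^sup>2 * y\<^sup>2"
    using mult_left_mono[of 1 "y\<^sup>2" "a\<^sup>2"] mult_right_mono[of 1 "a\<^sup>2" "y\<^sup>2"] by auto
  then have "- ((a * y)\<^sup>2) / 2 \<le> - (a\<^sup>2 / 4) + - (y\<^sup>2 / 4)"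
    by (simp add: power_mult_distrib)
  then have "gauss a y \<le> exp (- (a\<^sup>2 / 4)) * exp (- (y\<^sup>2 / 4))"
    unfolding gauss_def exp_add[symmetric] exp_le_cancel_iff .
  then have "a * gauss a y \<le> a * exp (- (a\<^sup>2 / 4)) * exp (- (y\<^sup>2 / 4))"
    using assms mult_left_mono[of _ _ a] by (simp add: mult.assoc)
  also have "a \<le> 1 + a\<^sup>2 / 4"
    using zero_le_power2[of "a / 2 - 1"] by (simp add: power2_eq_square algebra_simps)
  then have "a \<le> exp (a\<^sup>2 / 4)"
    using exp_ge_add_one_self[of "a\<^sup>2 / 4"] by linarith
  then have "a * exp (- (a\<^sup>2 / 4)) * exp (- (y\<^sup>2 / 4)) \<le> 1 * exp (- (y\<^sup>2 / 4))"
    by (intro mult_right_mono) (auto simp: exp_minus field_simps)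
  also have "\<dots> = gauss (1 / sqrt 2) y" by (simp add: gauss_def power_divide)
  finally show ?thesis .
qed

text \<open>\<open>h\<close> may be unbounded, so the line is split. Outside \<open>[-1, 1]\<close>
  the tail bound gives a majorant independent of \<open>n\<close>; inside, the continuous
  \<open>h\<close> is bounded and the kernel can be rescaled to unit width. The constant in the
  limit is the mass of \<open>gauss 1\<close>.\<close>

lemma gauss_approximate_identity:
  fixes h :: "real \<Rightarrow> complex"
  assumes h: "continuous_on UNIV h" and L2: "(\<integral>\<^sup>+y. ennreal ((cmod (h y))\<^sup>2) \<partial>lborel) < \<infinity>"
  shows "(\<lambda>n. LBINT y. h y * (real (Suc n) * gauss (real (Suc n)) y)) \<longlonglongrightarrow> sqrt (2 * pi) * h 0"
proof -
  have [measurable]: "h \<in> borel_measurable borel" by (rule borel_measurable_continuous_onI[OF h])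
  define k where "k = (\<lambda>n y. h y * (real (Suc n) * gauss (real (Suc n)) y))"
  have [measurable]: "k n \<in> borel_measurable borel" for n unfolding k_def by measurable
  define D where "D = (\<lambda>y. gauss (1 / sqrt 2) y + (cmod (h y))\<^sup>2)"
  have D: "integrable lborel D"
    unfolding D_def by (intro Bochner_Integration.integrable_add gauss_integrable integrable_square L2) auto
  have kD: "norm (k n y) \<le> D y" if "\<bar>y\<bar> \<ge> 1" for n y
  proof -
    have "norm (k n y) = cmod (h y) * (real (Suc n) * gauss (real (Suc n)) y)"
      by (simp add: k_def norm_mult del: of_nat_Suc)
    also have "\<dots> \<le> (1 + (cmod (h y))\<^sup>2) * gauss (1 / sqrt 2) y"
      using that by (intro mult_mono norm_le_1_plus_square gauss_tail_bound) auto
    also have "\<dots> \<le> D y"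
      using gauss_le_1[of "1 / sqrt 2" y] by (simp add: D_def ring_distribs mult_left_le)
    finally show ?thesis .
  qed
  have outer_lim: "(\<lambda>n. LBINT y. (1 - indicator {-1..1} y) *\<^sub>R k n y) \<longlonglongrightarrow> 0"
    and outer_int: "integrable lborel (\<lambda>y. (1 - indicator {-1..1} y) *\<^sub>R k n y)" for n
  proof -
    have bd: "norm ((1 - indicator {-1..1} y) *\<^sub>R k n y) \<le> D y" for y n
      using kD[of y n] by (auto simp: indicator_def D_def)
    show "integrable lborel (\<lambda>y. (1 - indicator {-1..1} y) *\<^sub>R k n y)" for n
      by (rule Bochner_Integration.integrable_bound[OF D]) (auto intro!: AE_I2 order_trans[OF bd] simp del: norm_scaleR)
    show "(\<lambda>n. LBINT y. (1 - indicator {-1..1} y) *\<^sub>R k n y) \<longlonglongrightarrow> 0"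
    proof (rule integral_dominated_convergence[where w = D and f = "\<lambda>_::real. 0::complex" and M = lborel, simplified])
      show "AE y in lborel. (\<lambda>n. (1 - indicator {-1..1} y) *\<^sub>R k n y) \<longlonglongrightarrow> 0"
      proof (rule AE_I2)
        fix y :: real
        show "(\<lambda>n. (1 - indicator {-1..1} y) *\<^sub>R k n y) \<longlonglongrightarrow> 0"
        proof (cases "y = 0")
          case False
          define z where "z = y\<^sup>2"
          have "z > 0" using False by (simp add: z_def)
          then have "(\<lambda>n. real (Suc n) * exp (- ((real (Suc n))\<^sup>2 * z) / 2)) \<longlonglongrightarrow> 0"
            by real_asymp
          then have "(\<lambda>n. real (Suc n) * gauss (real (Suc n)) y) \<longlonglongrightarrow> 0"
            by (simp add: gauss_def z_def power_mult_distrib)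
          then have "(\<lambda>n. (1 - indicator {-1..1} y) *\<^sub>R (h y * complex_of_real (real (Suc n) * gauss (real (Suc n)) y)))
              \<longlonglongrightarrow> (1 - indicator {-1..1} y) *\<^sub>R (h y * complex_of_real 0)"
            by (intro tendsto_intros)
          then show ?thesis by (simp add: k_def)
        qed simp
      qed
    qed (use D bd in \<open>auto\<close>)
  qed
  \<comment> \<open>The integrand over \<open>[-1, 1]\<close> after \<open>y = x / Suc n\<close>:
    the window grows to the whole line while the kernel stays \<open>gauss 1\<close>, and continuity
    of \<open>h\<close> at 0 gives the pointwise limit.\<close>
  define w where "w = (\<lambda>n x. (if \<bar>x\<bar> \<le> real (Suc n) then h (x / real (Suc n)) else 0) * gauss 1 x)"
  have inner_eq: "(LBINT y. indicator {-1..1} y *\<^sub>R k n y) = (LBINT x. w n x)" for n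
    apply (subst lborel_integral_real_affine[of "1 / real (Suc n)" _ 0])
     apply simp
    apply (subst integral_scaleR_right[symmetric])
    apply (rule Bochner_Integration.integral_cong[OF refl])
    apply (auto simp: w_def k_def indicator_def gauss_def abs_le_iff scaleR_conv_of_real divide_simps simp del: of_nat_Suc)
    done
  have inner_int: "integrable lborel (\<lambda>y. indicator {-1..1} y *\<^sub>R k n y)" for n
  proof -
    have "continuous_on {-1..1} (k n)"
      unfolding k_def gauss_def by (intro continuous_intros continuous_on_subset[OF h]) auto
    from borel_integrable_atLeastAtMost'[OF this] show ?thesis by (simp add: set_integrable_def)
  qed
  have hB: "bounded (h ` {-1..1})"
    by (intro compact_imp_bounded compact_continuous_image continuous_on_subset[OF h]) auto
  obtain B where B: "\<And>y. y \<in> {-1..1} \<Longrightarrow> cmod (h y) \<le> B"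
    using hB unfolding bounded_iff by blast
  have B0: "B \<ge> 0" using order_trans[OF norm_ge_zero B[of 0]] by simp
  have "(\<lambda>n. LBINT x. w n x) \<longlonglongrightarrow> (LBINT x. h 0 * gauss 1 x)"
  proof (rule integral_dominated_convergence[where w = "\<lambda>x. B * gauss 1 x"])
    show "AE x in lborel. (\<lambda>n. w n x) \<longlonglongrightarrow> h 0 * gauss 1 x"
    proof (rule AE_I2)
      fix x :: real
      have "isCont h 0" using h by (simp add: continuous_on_eq_continuous_at)
      then have "(\<lambda>n. h (x / real (Suc n))) \<longlonglongrightarrow> h 0"
        by (rule isCont_tendsto_compose) real_asymp
      then have "(\<lambda>n. h (x / real (Suc n)) * gauss 1 x) \<longlonglongrightarrow> h 0 * gauss 1 x"
        by (intro tendsto_intros)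
      moreover have "\<forall>\<^sub>F n in sequentially. \<bar>x\<bar> \<le> real (Suc n)"
        by real_asymp
      then have "\<forall>\<^sub>F n in sequentially. h (x / real (Suc n)) * gauss 1 x = w n x"
        by eventually_elim (simp add: w_def)
      ultimately show "(\<lambda>n. w n x) \<longlonglongrightarrow> h 0 * gauss 1 x"
        by (rule Lim_transform_eventually)
    qed
    show "AE x in lborel. norm (w n x) \<le> B * gauss 1 x" for n
      using B0 by (intro AE_I2) (auto simp: w_def norm_mult divide_simps abs_le_iff intro!: mult_right_mono B)
    show "w n \<in> borel_measurable lborel" for n unfolding w_def by measurable
  qed (use gauss_integrable[of 1] in \<open>auto\<close>)
  also have "(LBINT x. h 0 * gauss 1 x) = sqrt (2 * pi) * h 0"
    using has_bochner_integral_gauss[of 1] by (simp add: has_bochner_integral_iff)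
  finally have "(\<lambda>n. (LBINT x. w n x) + (LBINT y. (1 - indicator {-1..1} y) *\<^sub>R k n y)) \<longlonglongrightarrow> sqrt (2 * pi) * h 0 + 0"
    by (intro tendsto_add outer_lim)
  also have "(\<lambda>n. (LBINT x. w n x) + (LBINT y. (1 - indicator {-1..1} y) *\<^sub>R k n y)) = (\<lambda>n. LBINT y. k n y)"
    unfolding inner_eq[symmetric]
    by (subst Bochner_Integration.integral_add[symmetric, OF inner_int outer_int]) (simp flip: scaleR_left.add)
  finally show ?thesis by (simp add: k_def)
qed

text \<open>On the support, which has finite measure, \<open>1 + (cmod (F t))^2\<close> is an
  integrable majorant. In this way the band limit turns an \<open>L2\<close> spectrum into one whose
  inversion integral converges absolutely.\<close>

lemma integrable_of_square_compact_support:
  fixes F :: "real \<Rightarrow> complex"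
  assumes [measurable]: "F \<in> borel_measurable borel"
    and L2: "(\<integral>\<^sup>+t. ennreal ((cmod (F t))\<^sup>2) \<partial>lborel) < \<infinity>"
    and supp: "\<And>t. \<bar>t\<bar> > T \<Longrightarrow> F t = 0"
  shows "integrable lborel F"
proof (rule Bochner_Integration.integrable_bound)
  show "integrable lborel (\<lambda>t. indicator {-T..T} t + (cmod (F t))\<^sup>2)"
    by (intro Bochner_Integration.integrable_add integrable_square L2 integrable_real_indicator) (auto simp: emeasure_lborel_Icc_eq)
  show "AE t in lborel. norm (F t) \<le> norm (indicator {-T..T} t + (cmod (F t))\<^sup>2)"
  proof (rule AE_I2)
    fix t show "norm (F t) \<le> norm (indicator {-T..T} t + (cmod (F t))\<^sup>2)"
      using norm_le_1_plus_square[of "F t"] supp[of t] by (cases "\<bar>t\<bar> > T") (auto simp: indicator_def)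
  qed
qed auto

text \<open>Both sides are tested against \<open>P s\<close>, a Gaussian modulated by
  \<open>iexp (- (x * t))\<close>. For fixed \<open>s\<close> the truncation is removed on the
  spectral side by the \<open>L2\<close> limit and on the side of \<open>h\<close> by dominated
  convergence; only then does \<open>s\<close> tend to 0. The constant \<open>2 * pi\<close> is a
  product of two factors \<open>sqrt (2 * pi)\<close>, one from the transform of a Gaussian and one
  from its mass.\<close>

lemma fourier_inversion_L2:
  fixes h F :: "real \<Rightarrow> complex"
  assumes h: "continuous_on UNIV h" and L2: "(\<integral>\<^sup>+y. ennreal ((cmod (h y))\<^sup>2) \<partial>lborel) < \<infinity>"
    and F: "integrable lborel F"
    and lim: "((\<lambda>R. \<integral>\<^sup>+t. ennreal ((cmod (fourier (truncate R h) t - F t))\<^sup>2) \<partial>lborel) \<longlongrightarrow> 0) at_top"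
  shows "fourier F (- x) = 2 * pi * h x"
proof -
  have [measurable]: "h \<in> borel_measurable borel" "F \<in> borel_measurable borel"
    using borel_measurable_continuous_onI[OF h] F by auto
  define P where "P = (\<lambda>s t. complex_of_real (gauss s t) * iexp (- (x * t)))"
  have P_meas [measurable]: "P s \<in> borel_measurable borel" for s
    unfolding P_def by measurable
  have normP: "cmod (P s t) = gauss s t" for s t by (simp add: P_def norm_mult)
  have P_int: "integrable lborel (P s)" if "s > 0" for s
    unfolding P_def by (rule integrable_mult_bounded(1)[where B = 1]) (use gauss_integrable[OF that] in auto)
  have fP: "fourier (P s) y = sqrt (2 * pi) / s * gauss (1 / s) (y - x)" if "s > 0" for s y
  proof -
    have "fourier (P s) y = fourier (\<lambda>t. gauss s t) (y - x)"
      by (simp add: fourier_def P_def mult_ac ring_distribs mult_exp_exp)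
    then show ?thesis by (simp add: fourier_gauss[OF that])
  qed
  have key: "(LBINT t. F t * P s t) = (LBINT y. h y * (sqrt (2 * pi) / s * gauss (1 / s) (y - x)))" if s: "s > 0" for s
  proof -
    define f where "f = (\<lambda>n::nat. fourier (truncate (real n) h))"
    have tr: "integrable lborel (truncate R h)" for R by (rule truncate_integrable[OF h])
    have [measurable]: "f n \<in> borel_measurable borel" for n
      unfolding f_def using fourier_measurable[of "truncate (real n) h"] by simp
    have fP_int: "integrable lborel (\<lambda>t. f n t * P s t)" for n
      unfolding f_def by (rule integrable_mult_bounded(2)[OF P_int[OF s] _ norm_fourier_le])
        (use fourier_measurable[of "truncate (real n) h"] in simp)
    have FP_int: "integrable lborel (\<lambda>t. F t * P s t)"
      by (rule integrable_mult_bounded(1)[OF F, where B = 1]) (auto simp: normP gauss_le_1)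
    \<comment> \<open>Cauchy-Schwarz, with \<open>A\<close> the squared norm of \<open>P s\<close>
      and \<open>E n\<close> the squared \<open>L2\<close> error of the truncated transform.\<close>
    have L: "(\<lambda>n. LBINT t. f n t * P s t) \<longlonglongrightarrow> (LBINT t. F t * P s t)"
    proof -
      define E where "E = (\<lambda>n. \<integral>\<^sup>+t. ennreal ((cmod (f n t - F t))\<^sup>2) \<partial>lborel)"
      define A where "A = (\<integral>\<^sup>+t. ennreal (gauss s t)^2 \<partial>lborel)"
      have "A \<le> (\<integral>\<^sup>+t. ennreal (gauss s t) \<partial>lborel)"
        unfolding A_def by (intro nn_integral_mono) (auto simp: ennreal_power power2_eq_square intro!: ennreal_leI mult_left_le gauss_le_1)
      also have "\<dots> < \<infinity>" using nn_integral_gauss[OF s, of 0] by simp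
      finally have A: "A < \<infinity>" .
      have E: "E \<longlonglongrightarrow> 0"
        unfolding E_def f_def by (rule filterlim_compose[OF lim filterlim_real_sequentially])
      have bd: "ennreal ((cmod ((LBINT t. f n t * P s t) - (LBINT t. F t * P s t)))\<^sup>2) \<le> A * E n" for n
      proof -
        have "(LBINT t. f n t * P s t) - (LBINT t. F t * P s t) = (LBINT t. (f n t - F t) * P s t)"
          by (subst Bochner_Integration.integral_diff[symmetric, OF fP_int FP_int]) (simp add: algebra_simps)
        also have "ennreal (cmod (LBINT t. (f n t - F t) * P s t)) \<le> (\<integral>\<^sup>+t. ennreal (cmod ((f n t - F t) * P s t)) \<partial>lborel)"
          using Bochner_Integration.integrable_diff[OF fP_int FP_int, of n]
          by (intro integral_norm_bound_ennreal) (simp add: algebra_simps)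
        also have "\<dots> = (\<integral>\<^sup>+t. ennreal (cmod (f n t - F t)) * ennreal (gauss s t) \<partial>lborel)"
          by (simp add: norm_mult normP ennreal_mult)
        finally have "(ennreal (cmod ((LBINT t. f n t * P s t) - (LBINT t. F t * P s t))))\<^sup>2 \<le>
           (\<integral>\<^sup>+t. ennreal (cmod (f n t - F t)) * ennreal (gauss s t) \<partial>lborel)\<^sup>2"
          by (intro power_mono) auto
        also have "\<dots> \<le> (\<integral>\<^sup>+t. ennreal (cmod (f n t - F t)) ^ 2 \<partial>lborel) * A"
          unfolding A_def by (rule Cauchy_Schwarz_nn_integral) measurable
        finally show ?thesis by (simp add: E_def ennreal_power mult.commute)
      qed
      have AE0: "(\<lambda>n. A * E n) \<longlonglongrightarrow> 0"
        using ennreal_tendsto_cmult[OF _ E, of A] A by simp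
      have "(\<lambda>n. ennreal ((cmod ((LBINT t. f n t * P s t) - (LBINT t. F t * P s t)))\<^sup>2)) \<longlonglongrightarrow> 0"
        by (rule tendsto_sandwich[OF always_eventually always_eventually tendsto_const AE0])
          (rule allI, (rule zero_le bd))+
      then have "(\<lambda>n. (cmod ((LBINT t. f n t * P s t) - (LBINT t. F t * P s t)))\<^sup>2) \<longlonglongrightarrow> 0"
        by (rule ennreal_tendsto_0_iff[THEN iffD1, rotated]) simp
      then have "(\<lambda>n. sqrt ((cmod ((LBINT t. f n t * P s t) - (LBINT t. F t * P s t)))\<^sup>2)) \<longlonglongrightarrow> sqrt 0"
        by (rule tendsto_real_sqrt)
      then show ?thesis by (simp add: tendsto_norm_zero_iff LIM_zero_iff)
    qed
    define G where "G = (\<lambda>y. sqrt (2 * pi) / s * gauss (1 / s) (y - x))"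
    have [measurable]: "G \<in> borel_measurable borel" unfolding G_def by measurable
    have G_int: "integrable lborel G"
      unfolding G_def using lborel_integrable_real_affine[OF gauss_integrable[of "1 / s"], of 1 "-x"] s by simp
    have G_nonneg: "G y \<ge> 0" for y using s by (simp add: G_def)
    have G_bd: "G y \<le> sqrt (2 * pi) / s" for y
      unfolding G_def using s gauss_le_1 by (intro mult_left_le) auto
    have "(\<lambda>n. LBINT y. truncate (real n) h y * G y) \<longlonglongrightarrow> (LBINT y. h y * G y)"
    proof (rule integral_dominated_convergence[where w = "\<lambda>y. G y + (cmod (h y))\<^sup>2 * (sqrt (2 * pi) / s)"])
      show "integrable lborel (\<lambda>y. G y + (cmod (h y))\<^sup>2 * (sqrt (2 * pi) / s))"
        by (intro Bochner_Integration.integrable_add G_int integrable_mult_left integrable_square L2) auto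
      show "AE y in lborel. (\<lambda>n. truncate (real n) h y * G y) \<longlonglongrightarrow> h y * G y"
      proof (rule AE_I2)
        fix y :: real
        have "\<forall>\<^sub>F n in sequentially. \<bar>y\<bar> \<le> real n" by real_asymp
        then have "\<forall>\<^sub>F n in sequentially. h y * G y = truncate (real n) h y * G y"
          by eventually_elim (simp add: truncate_def indicator_def abs_le_iff)
        then show "(\<lambda>n. truncate (real n) h y * G y) \<longlonglongrightarrow> h y * G y"
          by (rule Lim_transform_eventually[OF tendsto_const])
      qed
      show "AE y in lborel. norm (truncate (real n) h y * G y) \<le> G y + (cmod (h y))\<^sup>2 * (sqrt (2 * pi) / s)" for n
      proof (rule AE_I2)
        fix y
        have "norm (truncate (real n) h y * G y) \<le> cmod (h y) * G y"
          using G_nonneg by (auto simp: truncate_def norm_mult indicator_def)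
        also have "\<dots> \<le> (1 + (cmod (h y))\<^sup>2) * G y"
          by (intro mult_right_mono norm_le_1_plus_square G_nonneg)
        also have "\<dots> = G y + (cmod (h y))\<^sup>2 * G y" by (simp add: ring_distribs)
        also have "\<dots> \<le> G y + (cmod (h y))\<^sup>2 * (sqrt (2 * pi) / s)"
          by (intro add_left_mono mult_left_mono G_bd) auto
        finally show "norm (truncate (real n) h y * G y) \<le> \<dots>" .
      qed
    qed measurable
    moreover have "(LBINT t. f n t * P s t) = (LBINT y. truncate (real n) h y * G y)" for n
      unfolding f_def fourier_mult_formula[OF tr P_int[OF s]] fP[OF s] G_def ..
    ultimately show ?thesis
      using L LIMSEQ_unique by (auto simp: G_def)
  qed
  have "(\<lambda>n. LBINT t. F t * P (1 / real (Suc n)) t) \<longlonglongrightarrow> (LBINT t. F t * iexp (- x * t))"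
  proof (rule integral_dominated_convergence[where w = "\<lambda>t. norm (F t)"])
    show "AE t in lborel. (\<lambda>n. F t * P (1 / real (Suc n)) t) \<longlonglongrightarrow> F t * iexp (- x * t)"
    proof (rule AE_I2)
      fix t
      have "(\<lambda>n. gauss (1 / real (Suc n)) t) \<longlonglongrightarrow> exp (- (0 * t)\<^sup>2 / 2)"
        unfolding gauss_def by (intro tendsto_intros LIMSEQ_Suc[OF lim_1_over_n]) auto
      then have "(\<lambda>n. F t * P (1 / real (Suc n)) t) \<longlonglongrightarrow> F t * (complex_of_real (exp (- (0 * t)\<^sup>2 / 2)) * iexp (- (x * t)))"
        unfolding P_def by (intro tendsto_intros)
      then show "(\<lambda>n. F t * P (1 / real (Suc n)) t) \<longlonglongrightarrow> F t * iexp (- x * t)" by simp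
    qed
    show "AE t in lborel. norm (F t * P (1 / real (Suc n)) t) \<le> norm (F t)" for n
      by (intro AE_I2) (auto simp: norm_mult normP gauss_le_1 intro!: mult_left_le)
  qed (use F in \<open>auto\<close>)
  then have 1: "(\<lambda>n. LBINT t. F t * P (1 / real (Suc n)) t) \<longlonglongrightarrow> fourier F (- x)"
    by (simp add: fourier_def)
  \<comment> \<open>For \<open>s = 1 / Suc n\<close> the kernel has parameter \<open>Suc n\<close>,
    and translation by \<open>x\<close> centres it at 0, which is the form treated by
    \<open>gauss_approximate_identity\<close>.\<close>
  have "(LBINT t. F t * P (1 / real (Suc n)) t) = sqrt (2 * pi) * (LBINT y. h (x + y) * (real (Suc n) * gauss (real (Suc n)) y))" for n
  proof -
    have "(LBINT t. F t * P (1 / real (Suc n)) t) = (LBINT y. h y * (sqrt (2 * pi) * real (Suc n) * gauss (real (Suc n)) (y - x)))"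
      by (subst key) auto
    also have "\<dots> = (LBINT y. h (x + 1 * y) * (sqrt (2 * pi) * real (Suc n) * gauss (real (Suc n)) (x + 1 * y - x)))"
      by (subst lborel_integral_real_affine[of 1 _ x]) auto
    also have "\<dots> = (LBINT y. sqrt (2 * pi) * (h (x + y) * (real (Suc n) * gauss (real (Suc n)) y)))"
      by (intro Bochner_Integration.integral_cong) auto
    finally show ?thesis by simp
  qed
  moreover have "(\<lambda>n. LBINT y. h (x + y) * (real (Suc n) * gauss (real (Suc n)) y)) \<longlonglongrightarrow> sqrt (2 * pi) * h (x + 0)"
  proof (rule gauss_approximate_identity)
    show "continuous_on UNIV (\<lambda>y. h (x + y))" by (intro continuous_on_compose2[OF h] continuous_intros) auto
    have "(\<integral>\<^sup>+y. ennreal ((cmod (h (x + y)))\<^sup>2) \<partial>lborel) = (\<integral>\<^sup>+y. ennreal ((cmod (h y))\<^sup>2) \<partial>lborel)"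
      by (subst (2) nn_integral_real_affine[of _ 1 x]) auto
    then show "(\<integral>\<^sup>+y. ennreal ((cmod (h (x + y)))\<^sup>2) \<partial>lborel) < \<infinity>" using L2 by simp
  qed
  ultimately have "(\<lambda>n. LBINT t. F t * P (1 / real (Suc n)) t) \<longlonglongrightarrow> sqrt (2 * pi) * (sqrt (2 * pi) * h x)"
    by (auto intro!: tendsto_mult_left)
  from LIMSEQ_unique[OF 1 this] show ?thesis
    by (simp flip: of_real_mult mult.assoc)
qed

subsection \<open>Truncated Fourier integrals of functions of exponential type\<close>

text \<open>The increment of the primitive \<open>G\<close> is the integral along a vertical side at
  abscissa \<open>c R\<close>, later \<open>R\<close> or \<open>- R\<close>. The side grows with
  \<open>R\<close> and \<open>H\<close> is assumed to vanish only pointwise in \<open>v\<close>;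
  dominated convergence copes with both, since the integrand is at most
  \<open>C * exp (- (v * (t - T)))\<close>, integrable because \<open>t > T\<close>.\<close>

lemma vertical_increment_tendsto_0:
  fixes H G :: "complex \<Rightarrow> complex" and c :: "real \<Rightarrow> real" and t T :: real
  assumes H: "H holomorphic_on UNIV" and bound: "\<And>z. cmod (H z) \<le> C * exp (T * \<bar>Im z\<bar>)"
    and G: "\<And>z. (G has_field_derivative H z * exp (\<i> * t * z)) (at z)"
    and lim: "\<And>v. ((\<lambda>R. H (Complex (c R) v)) \<longlongrightarrow> 0) at_top"
    and t: "t > T"
  shows "((\<lambda>R. G (Complex (c R) R) - G (Complex (c R) 0)) \<longlongrightarrow> 0) at_top"
proof -
  define E where "E = (\<lambda>z. H z * exp (\<i> * t * z))"
  have contE: "continuous_on UNIV E"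
    unfolding E_def by (intro continuous_intros holomorphic_on_imp_continuous_on H)
  have nE: "cmod (E (Complex u v)) = cmod (H (Complex u v)) * exp (- (t * v))" for u v
    by (simp add: E_def norm_mult)
  have bdE: "cmod (E (Complex u v)) \<le> C * exp (- (v * (t - T)))" if "v \<ge> 0" for u v
  proof -
    have "cmod (E (Complex u v)) \<le> (C * exp (T * v)) * exp (- (t * v))"
      unfolding nE using bound[of "Complex u v"] that by (intro mult_right_mono) auto
    then show ?thesis by (simp add: algebra_simps exp_diff exp_minus exp_add divide_inverse)
  qed
  have C0: "C \<ge> 0" using order_trans[OF norm_ge_zero bound[of 0]] by simp
  have contl: "continuous_on A (\<lambda>v. E (Complex u v))" for A u
    unfolding Complex_eq by (intro continuous_on_compose2[OF contE] continuous_intros) auto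
  have eq: "(LBINT v. indicator {0..R} v *\<^sub>R (\<i> * E (Complex (c R) v)))
      = G (Complex (c R) R) - G (Complex (c R) 0)" if "R \<ge> 0" for R
  proof (rule integral_FTC_Icc[OF that])
    show "((\<lambda>v. G (Complex (c R) v)) has_vector_derivative \<i> * E (Complex (c R) v)) (at v within {0..R})" for v
    proof -
      have "((\<lambda>v. Complex (c R) v) has_vector_derivative \<i>) (at v within {0..R})"
        unfolding Complex_eq by (auto intro!: derivative_eq_intros)
      from field_vector_diff_chain_within[OF this has_field_derivative_at_within[OF G]]
      show ?thesis by (simp add: o_def E_def mult_ac)
    qed
  qed (intro continuous_intros contl)
  have "((\<lambda>R. LBINT v. indicator {0..R} v *\<^sub>R (\<i> * E (Complex (c R) v))) \<longlongrightarrow> integral\<^sup>L lborel (\<lambda>_::real. 0::complex)) at_top"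
  proof (rule integral_dominated_convergence_at_top[where w = "\<lambda>v. indicator {0..} v * (C * exp (- (v * (t - T))))"])
    show "integrable lborel (\<lambda>v. indicator {0..} v * (C * exp (- (v * (t - T)))))"
    proof -
      have "integrable lborel (\<lambda>v. C * (indicator {0<..} v *\<^sub>R exp (- (v * (t - T)))))"
        using integrable_I0i_exp_mscale[of "t - T"] t unfolding set_integrable_def by (intro integrable_mult_right) auto
      then show ?thesis
        by (rule integrable_cong_AE_imp)
          (auto simp: indicator_def intro!: AE_I[of _ _ "{0}"])
    qed
    show "AE v in lborel. ((\<lambda>R. indicator {0..R} v *\<^sub>R (\<i> * E (Complex (c R) v))) \<longlongrightarrow> 0) at_top"
    proof (rule AE_I2)
      fix v :: real
      have "((\<lambda>R. exp (- (t * v)) * cmod (H (Complex (c R) v))) \<longlongrightarrow> exp (- (t * v)) * 0) at_top"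
        by (intro tendsto_intros tendsto_norm_zero lim)
      then have 0: "((\<lambda>R. exp (- (t * v)) * cmod (H (Complex (c R) v))) \<longlongrightarrow> 0) at_top" by simp
      show "((\<lambda>R. indicator {0..R} v *\<^sub>R (\<i> * E (Complex (c R) v))) \<longlongrightarrow> 0) at_top"
        by (rule Lim_null_comparison[OF _ 0]) (auto simp: nE indicator_def norm_mult intro!: always_eventually)
    qed
    show "\<forall>\<^sub>F R in at_top. AE v in lborel. norm (indicator {0..R} v *\<^sub>R (\<i> * E (Complex (c R) v)))
        \<le> indicator {0..} v * (C * exp (- (v * (t - T))))"
      using bdE by (intro always_eventually allI AE_I2) (auto simp: indicator_def norm_mult C0)
    show "(\<lambda>v. indicator {0..R} v *\<^sub>R (\<i> * E (Complex (c R) v))) \<in> borel_measurable lborel" for R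
      using borel_measurable_continuous_onI[OF contl[of UNIV "c R"]] by simp
  qed auto
  then have "((\<lambda>R. LBINT v. indicator {0..R} v *\<^sub>R (\<i> * E (Complex (c R) v))) \<longlongrightarrow> 0) at_top" by simp
  moreover have "\<forall>\<^sub>F R in at_top. (LBINT v. indicator {0..R} v *\<^sub>R (\<i> * E (Complex (c R) v)))
      = G (Complex (c R) R) - G (Complex (c R) 0)"
    using eventually_ge_at_top[of 0] by eventually_elim (rule eq)
  ultimately show ?thesis by (rule Lim_transform_eventually)
qed

text \<open>A global primitive \<open>G\<close> of the entire integrand takes the place of Cauchy's
  theorem: each side of the rectangle is a difference of values of \<open>G\<close> at two corners.
  As the height grows with the width, the top side of length \<open>2 * R\<close> is beaten by
  \<open>exp (- (R * (t - T)))\<close>.\<close>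

lemma fourier_truncate_tendsto_0_aux:
  fixes H :: "complex \<Rightarrow> complex"
  assumes H: "H holomorphic_on UNIV" and bound: "\<And>z. cmod (H z) \<le> C * exp (T * \<bar>Im z\<bar>)"
    and lim: "\<And>v. ((\<lambda>u. H (Complex u v)) \<longlongrightarrow> 0) at_top" "\<And>v. ((\<lambda>u. H (Complex u v)) \<longlongrightarrow> 0) at_bot"
    and t: "t > T"
  shows "((\<lambda>R. fourier (truncate R (\<lambda>y. H (of_real y))) t) \<longlongrightarrow> 0) at_top"
proof -
  define E where "E = (\<lambda>z. H z * exp (\<i> * t * z))"
  have "E holomorphic_on UNIV" unfolding E_def by (intro holomorphic_intros H)
  then obtain G where G: "\<And>z. (G has_field_derivative H z * exp (\<i> * t * z)) (at z)"
    using holomorphic_convex_primitive'[of UNIV E] unfolding E_def by auto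
  have 1: "((\<lambda>R. G (Complex R R) - G (Complex R 0)) \<longlongrightarrow> 0) at_top"
    by (rule vertical_increment_tendsto_0[OF H bound G _ t]) (rule lim)
  have 2: "((\<lambda>R. G (Complex (- R) R) - G (Complex (- R) 0)) \<longlongrightarrow> 0) at_top"
  proof (rule vertical_increment_tendsto_0[OF H bound G _ t])
    show "((\<lambda>R. H (Complex (- R) v)) \<longlongrightarrow> 0) at_top" for v
      using filterlim_compose[OF lim(2) filterlim_uminus_at_bot_at_top] .
  qed
  have 3: "((\<lambda>R. G (Complex R R) - G (Complex (- R) R)) \<longlongrightarrow> 0) at_top"
  proof (rule Lim_null_comparison)
    show "\<forall>\<^sub>F R in at_top. norm (G (Complex R R) - G (Complex (- R) R)) \<le> C * exp (- (R * (t - T))) * (2 * R)"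
      using eventually_ge_at_top[of 0]
    proof eventually_elim
      fix R :: real assume "0 \<le> R"
      have "norm (G (Complex R R) - G (Complex (- R) R)) \<le> C * exp (- (R * (t - T))) * norm (Complex R R - Complex (- R) R)"
      proof (rule field_differentiable_bound[of "{z. Im z = R}"])
        show "convex {z. Im z = R}" by (auto simp: convex_def simp flip: distrib_right)
        show "(G has_field_derivative E z) (at z within {z. Im z = R})" for z
          unfolding E_def by (rule has_field_derivative_at_within[OF G])
        fix z assume "z \<in> {z. Im z = R}"
        then have z: "Im z = R" by simp
        have "norm (E z) = cmod (H z) * exp (- (t * R))" by (simp add: E_def norm_mult z)
        also have "\<dots> \<le> (C * exp (T * R)) * exp (- (t * R))"
          using bound[of z] z \<open>0 \<le> R\<close> by (intro mult_right_mono) auto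
        finally show "norm (E z) \<le> C * exp (- (R * (t - T)))"
          by (simp add: algebra_simps exp_diff exp_minus exp_add divide_inverse)
      qed auto
      also have "Complex R R - Complex (- R) R = of_real (2 * R)"
        by (simp add: complex_eq_iff)
      also have "norm (of_real (2 * R) :: complex) = 2 * R"
        unfolding norm_of_real using \<open>0 \<le> R\<close> by simp
      finally show "norm (G (Complex R R) - G (Complex (- R) R)) \<le> C * exp (- (R * (t - T))) * (2 * R)" .
    qed
    have "0 < t - T" using t by simp
    then show "((\<lambda>R. C * exp (- (R * (t - T))) * (2 * R)) \<longlongrightarrow> 0) at_top"
      by real_asymp
  qed
  \<comment> \<open>The bottom side is top minus right plus left, by telescoping over the four
    corners.\<close>
  have "((\<lambda>R. (G (Complex R R) - G (Complex (- R) R)) - (G (Complex R R) - G (Complex R 0))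
        + (G (Complex (- R) R) - G (Complex (- R) 0))) \<longlongrightarrow> 0 - 0 + 0) at_top"
    by (intro tendsto_intros 1 2 3)
  then have "((\<lambda>R. G (Complex R 0) - G (Complex (- R) 0)) \<longlongrightarrow> 0) at_top"
    by (simp add: algebra_simps)
  moreover have "\<forall>\<^sub>F R in at_top. G (Complex R 0) - G (Complex (- R) 0) = fourier (truncate R (\<lambda>y. H (of_real y))) t"
    using eventually_ge_at_top[of 0]
  proof eventually_elim
    fix R :: real assume R: "0 \<le> R"
    have "(LBINT y. indicator {-R..R} y *\<^sub>R E (of_real y)) = G (of_real R) - G (of_real (- R))"
    proof (rule integral_FTC_Icc)
      show "((\<lambda>y. G (of_real y)) has_vector_derivative E (of_real y)) (at y within {-R..R})" for y
      proof -
        have "(of_real has_vector_derivative (1::complex)) (at y within {-R..R})"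
          by (auto intro!: derivative_eq_intros)
        from field_vector_diff_chain_within[OF this has_field_derivative_at_within[OF G]]
        show ?thesis by (simp add: o_def E_def mult_ac)
      qed
      show "continuous_on {-R..R} (\<lambda>y. E (of_real y))"
        unfolding E_def
        by (intro continuous_intros continuous_on_compose2[OF holomorphic_on_imp_continuous_on[OF H]]) auto
    qed (use R in auto)
    then show "G (Complex R 0) - G (Complex (- R) 0) = fourier (truncate R (\<lambda>y. H (of_real y))) t"
      unfolding complex_of_real_def[symmetric] by (simp add: fourier_def truncate_def E_def mult_ac)
  qed
  ultimately show ?thesis by (rule Lim_transform_eventually)
qed

text \<open>Frequencies below \<open>- T\<close> reduce to the previous case by passing to
  \<open>H (- z)\<close>: this preserves the growth bound, exchanges the two ends of each horizontal
  line up to a change of height, and reverses the sign of \<open>t\<close>.\<close>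

lemma fourier_truncate_tendsto_0:
  fixes H :: "complex \<Rightarrow> complex"
  assumes H: "H holomorphic_on UNIV" and bound: "\<And>z. cmod (H z) \<le> C * exp (T * \<bar>Im z\<bar>)"
    and lim: "\<And>v. ((\<lambda>u. H (Complex u v)) \<longlongrightarrow> 0) at_top" "\<And>v. ((\<lambda>u. H (Complex u v)) \<longlongrightarrow> 0) at_bot"
    and t: "\<bar>t\<bar> > T"
  shows "((\<lambda>R. fourier (truncate R (\<lambda>y. H (of_real y))) t) \<longlongrightarrow> 0) at_top"
proof (cases "t > T")
  case True
  then show ?thesis by (intro fourier_truncate_tendsto_0_aux[OF H bound lim])
next
  case False
  have "((\<lambda>R. fourier (truncate R (\<lambda>y. H (- of_real y))) (- t)) \<longlongrightarrow> 0) at_top"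
  proof (rule fourier_truncate_tendsto_0_aux[where H = "\<lambda>z. H (- z)"])
    show "(\<lambda>z. H (- z)) holomorphic_on UNIV"
      by (intro holomorphic_on_compose_gen[OF _ H, unfolded o_def] holomorphic_intros) auto
    show "cmod (H (- z)) \<le> C * exp (T * \<bar>Im z\<bar>)" for z using bound[of "- z"] by simp
    have m: "- Complex u v = Complex (- u) (- v)" for u v by (simp add: complex_eq_iff)
    show "((\<lambda>u. H (- Complex u v)) \<longlongrightarrow> 0) at_top" for v
      unfolding m using filterlim_compose[OF lim(2) filterlim_uminus_at_bot_at_top] .
    show "((\<lambda>u. H (- Complex u v)) \<longlongrightarrow> 0) at_bot" for v
      unfolding m using filterlim_compose[OF lim(1) filterlim_uminus_at_top_at_bot] .
    show "- t > T" using t False by linarith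
  qed
  moreover have "fourier (truncate R (\<lambda>y. H (- of_real y))) (- t) = fourier (truncate R (\<lambda>y. H (of_real y))) t" for R
    unfolding fourier_def
    by (subst lborel_integral_real_affine[of "-1" _ 0]) (auto simp: truncate_def indicator_def intro!: Bochner_Integration.integral_cong)
  ultimately show ?thesis by simp
qed

section \<open>Existence of the Fourier transform as an \<open>L2\<close> limit of
  truncations\<close>

lemma truncate_tail_tendsto_0:
  assumes [measurable]: "h \<in> borel_measurable borel" and L2: "(\<integral>\<^sup>+y. ennreal ((cmod (h y))\<^sup>2) \<partial>lborel) < \<infinity>"
  shows "(\<lambda>n. \<integral>\<^sup>+y. indicator {y. \<bar>y\<bar> > real n} y * ennreal ((cmod (h y))\<^sup>2) \<partial>lborel) \<longlonglongrightarrow> 0"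
proof -
  have "(\<lambda>n. \<integral>\<^sup>+y. indicator {y. \<bar>y\<bar> > real n} y * ennreal ((cmod (h y))\<^sup>2) \<partial>lborel) \<longlonglongrightarrow> nn_integral lborel (\<lambda>_::real. 0)"
  proof (rule nn_integral_dominated_convergence[where w = "\<lambda>y. ennreal ((cmod (h y))\<^sup>2)"])
    show "AE y in lborel. (\<lambda>n. indicator {y. \<bar>y\<bar> > real n} y * ennreal ((cmod (h y))\<^sup>2)) \<longlonglongrightarrow> 0"
    proof (rule AE_I2)
      fix y :: real
      have "\<forall>\<^sub>F n in sequentially. \<bar>y\<bar> \<le> real n" by real_asymp
      then have "\<forall>\<^sub>F n in sequentially. 0 = indicator {y. \<bar>y\<bar> > real n} y * ennreal ((cmod (h y))\<^sup>2)"
        by eventually_elim (simp add: indicator_def)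
      then show "(\<lambda>n. indicator {y. \<bar>y\<bar> > real n} y * ennreal ((cmod (h y))\<^sup>2)) \<longlonglongrightarrow> 0"
        by (rule Lim_transform_eventually[OF tendsto_const])
    qed
  qed (use L2 in \<open>auto simp: indicator_def intro!: AE_I2\<close>)
  then show ?thesis by simp
qed

text \<open>The inequality \<open>(a + b)^2 \<le> 2 * a^2 + 2 * b^2\<close> takes the place of
  Minkowski's; the factor 2 is harmless for finiteness and for limits equal to 0.\<close>

lemma nn_integral_norm_add_square_le:
  fixes f g :: "'a \<Rightarrow> complex"
  assumes [measurable]: "f \<in> borel_measurable M" "g \<in> borel_measurable M"
  shows "(\<integral>\<^sup>+t. ennreal ((cmod (f t + g t))\<^sup>2) \<partial>M)
     \<le> 2 * (\<integral>\<^sup>+t. ennreal ((cmod (f t))\<^sup>2) \<partial>M) + 2 * (\<integral>\<^sup>+t. ennreal ((cmod (g t))\<^sup>2) \<partial>M)"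
proof -
  have "(\<integral>\<^sup>+t. ennreal ((cmod (f t + g t))\<^sup>2) \<partial>M)
     \<le> (\<integral>\<^sup>+t. 2 * ennreal ((cmod (f t))\<^sup>2) + 2 * ennreal ((cmod (g t))\<^sup>2) \<partial>M)"
  proof (rule nn_integral_mono)
    fix t
    have "(cmod (f t + g t))\<^sup>2 \<le> (cmod (f t) + cmod (g t))\<^sup>2"
      by (intro power_mono norm_triangle_ineq) auto
    also have "\<dots> \<le> 2 * (cmod (f t))\<^sup>2 + 2 * (cmod (g t))\<^sup>2"
      using sum_squares_bound[of "cmod (f t)" "cmod (g t)"] by (simp add: power2_sum)
    finally have "ennreal ((cmod (f t + g t))\<^sup>2) \<le> ennreal (2 * (cmod (f t))\<^sup>2 + 2 * (cmod (g t))\<^sup>2)"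
      by (rule ennreal_leI)
    then show "ennreal ((cmod (f t + g t))\<^sup>2) \<le> 2 * ennreal ((cmod (f t))\<^sup>2) + 2 * ennreal ((cmod (g t))\<^sup>2)"
      by (simp add: ennreal_mult)
  qed
  also have "\<dots> = 2 * (\<integral>\<^sup>+t. ennreal ((cmod (f t))\<^sup>2) \<partial>M) + 2 * (\<integral>\<^sup>+t. ennreal ((cmod (g t))\<^sup>2) \<partial>M)"
    by (simp add: nn_integral_add nn_integral_cmult)
  finally show ?thesis .
qed

text \<open>Bessel's inequality, applied to the difference of two truncations, bounds their distance
  by \<open>\<tau>\<close>, a multiple of the tail of the squared norm of \<open>h\<close>; so the
  transforms at integer cut-offs are Cauchy. The subsequence \<open>r\<close> is part of the result
  because an \<open>L2\<close> limit alone cannot be compared with pointwise limits.\<close>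

lemma Plancherel_limit:
  fixes h :: "real \<Rightarrow> complex"
  assumes h: "continuous_on UNIV h" and L2: "(\<integral>\<^sup>+y. ennreal ((cmod (h y))\<^sup>2) \<partial>lborel) < \<infinity>"
  obtains F r where "F \<in> borel_measurable lborel" "strict_mono (r :: nat \<Rightarrow> nat)"
    "AE t in lborel. (\<lambda>n. fourier (truncate (real (r n)) h) t) \<longlonglongrightarrow> F t"
    "(\<integral>\<^sup>+t. ennreal ((cmod (F t))\<^sup>2) \<partial>lborel) < \<infinity>"
    "((\<lambda>R. \<integral>\<^sup>+t. ennreal ((cmod (fourier (truncate R h) t - F t))\<^sup>2) \<partial>lborel) \<longlongrightarrow> 0) at_top"
proof -
  have [measurable]: "h \<in> borel_measurable borel" by (rule borel_measurable_continuous_onI[OF h])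
  have tr: "integrable lborel (truncate R h)" for R by (rule truncate_integrable[OF h])
  define f where "f = (\<lambda>R. fourier (truncate R h))"
  have [measurable]: "f R \<in> borel_measurable borel" for R
    unfolding f_def using fourier_measurable[of "truncate R h"] by simp
  define \<tau> where "\<tau> = (\<lambda>n::nat. 2 * pi * (\<integral>\<^sup>+y. indicator {y. \<bar>y\<bar> > real n} y * ennreal ((cmod (h y))\<^sup>2) \<partial>lborel))"
  have \<tau>: "\<tau> \<longlonglongrightarrow> 0"
    unfolding \<tau>_def using ennreal_tendsto_cmult[OF _ truncate_tail_tendsto_0[OF _ L2], of "2 * pi"] by simp
  have diff: "(\<integral>\<^sup>+t. ennreal ((cmod (f R t - f S t))\<^sup>2) \<partial>lborel) \<le> \<tau> n" if "R \<ge> real n" "S \<ge> real n" for R S n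
  proof -
    have "f R t - f S t = fourier (\<lambda>y. truncate R h y - truncate S h y) t" for t
      using integrable_mult_bounded(1)[OF tr, where B = 1 and g = "\<lambda>y. iexp (t * y)"]
      unfolding f_def fourier_def by (subst Bochner_Integration.integral_diff[symmetric]) (auto simp: algebra_simps)
    then have "(\<integral>\<^sup>+t. ennreal ((cmod (f R t - f S t))\<^sup>2) \<partial>lborel)
       \<le> 2 * pi * (\<integral>\<^sup>+y. ennreal ((cmod (truncate R h y - truncate S h y))\<^sup>2) \<partial>lborel)"
      using fourier_Bessel[OF Bochner_Integration.integrable_diff[OF tr tr]] by simp
    also have "\<dots> \<le> \<tau> n"
      unfolding \<tau>_def using that
      by (intro mult_left_mono nn_integral_mono) (auto simp: truncate_def indicator_def)
    finally show ?thesis .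
  qed
  have Cauchy: "\<exists>N. \<forall>m\<ge>N. \<forall>n\<ge>N. (\<integral>\<^sup>+t. ennreal ((cmod (f (real m) t - f (real n) t))\<^sup>2) \<partial>lborel) \<le> e"
    if "e > 0" for e :: real
  proof -
    have "eventually (\<lambda>n. \<tau> n < ennreal e) sequentially"
      using that by (intro order_tendstoD(2)[OF \<tau>]) simp
    then obtain N where "\<tau> N < ennreal e" by (auto simp: eventually_sequentially)
    then show ?thesis
      by (intro exI[of _ N] allI impI order_trans[OF diff[of N]]) auto
  qed
  obtain F r where [measurable]: "F \<in> borel_measurable lborel" and r: "strict_mono (r :: nat \<Rightarrow> nat)"
    and ae: "AE t in lborel. (\<lambda>n. f (real (r n)) t) \<longlonglongrightarrow> F t"
    and e: "(\<lambda>n. \<integral>\<^sup>+t. ennreal ((cmod (f (real n) t - F t))\<^sup>2) \<partial>lborel) \<longlonglongrightarrow> 0"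
    by (rule L2_complete[of "\<lambda>n. f (real n)" lborel, OF _ Cauchy]) auto
  define \<epsilon> where "\<epsilon> = (\<lambda>n::nat. \<integral>\<^sup>+t. ennreal ((cmod (f (real n) t - F t))\<^sup>2) \<partial>lborel)"
  have \<epsilon>: "\<epsilon> \<longlonglongrightarrow> 0" using e by (simp add: \<epsilon>_def)
  have "(\<integral>\<^sup>+t. ennreal ((cmod (F t))\<^sup>2) \<partial>lborel) < \<infinity>"
  proof -
    have "eventually (\<lambda>n. \<epsilon> n < 1) sequentially"
      by (intro order_tendstoD(2)[OF \<epsilon>]) simp
    then obtain n where n: "\<epsilon> n < 1" by (auto simp: eventually_sequentially)
    have "(\<integral>\<^sup>+t. ennreal ((cmod (F t))\<^sup>2) \<partial>lborel) = (\<integral>\<^sup>+t. ennreal ((cmod ((F t - f (real n) t) + f (real n) t))\<^sup>2) \<partial>lborel)"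
      by simp
    also have "\<dots> \<le> 2 * (\<integral>\<^sup>+t. ennreal ((cmod (F t - f (real n) t))\<^sup>2) \<partial>lborel) + 2 * (\<integral>\<^sup>+t. ennreal ((cmod (f (real n) t))\<^sup>2) \<partial>lborel)"
      by (rule nn_integral_norm_add_square_le) measurable
    also have "(\<integral>\<^sup>+t. ennreal ((cmod (F t - f (real n) t))\<^sup>2) \<partial>lborel) = \<epsilon> n"
      by (simp add: \<epsilon>_def norm_minus_commute)
    also have "(\<integral>\<^sup>+t. ennreal ((cmod (f (real n) t))\<^sup>2) \<partial>lborel) \<le> 2 * pi * (\<integral>\<^sup>+y. ennreal ((cmod (truncate (real n) h y))\<^sup>2) \<partial>lborel)"
      unfolding f_def by (rule fourier_Bessel[OF tr])
    also have "(\<integral>\<^sup>+y. ennreal ((cmod (truncate (real n) h y))\<^sup>2) \<partial>lborel) \<le> (\<integral>\<^sup>+y. ennreal ((cmod (h y))\<^sup>2) \<partial>lborel)"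
      by (intro nn_integral_mono) (auto simp: truncate_def indicator_def)
    finally have le: "(\<integral>\<^sup>+t. ennreal ((cmod (F t))\<^sup>2) \<partial>lborel) \<le> 2 * \<epsilon> n + 2 * (2 * pi * (\<integral>\<^sup>+y. ennreal ((cmod (h y))\<^sup>2) \<partial>lborel))"
      by (simp add: mult_left_mono add_left_mono)
    have "2 * \<epsilon> n + 2 * (2 * pi * (\<integral>\<^sup>+y. ennreal ((cmod (h y))\<^sup>2) \<partial>lborel)) < \<infinity>"
      using n L2 by (auto simp: ennreal_mult_less_top less_top intro: less_trans)
    with le show ?thesis by (rule le_less_trans)
  qed
  \<comment> \<open>Completeness speaks of sequences, so a real cut-off \<open>R\<close> is compared
    with the integer one \<open>nat \<lfloor>R\<rfloor>\<close>, at a cost again bounded by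
    \<open>\<tau>\<close>.\<close>
  moreover have "((\<lambda>R. \<integral>\<^sup>+t. ennreal ((cmod (f R t - F t))\<^sup>2) \<partial>lborel) \<longlongrightarrow> 0) at_top"
  proof (rule tendsto_sandwich[OF always_eventually _ tendsto_const])
    have fl: "filterlim (\<lambda>R. nat \<lfloor>R\<rfloor>) sequentially (at_top :: real filter)"
      by (rule filterlim_compose[OF filterlim_nat_sequentially filterlim_floor_sequentially])
    have "(\<lambda>n. 2 * \<tau> n + 2 * \<epsilon> n) \<longlonglongrightarrow> 2 * 0 + 2 * 0"
      by (rule tendsto_add[OF ennreal_tendsto_cmult[OF _ \<tau>] ennreal_tendsto_cmult[OF _ \<epsilon>]]) auto
    then have "(\<lambda>n. 2 * \<tau> n + 2 * \<epsilon> n) \<longlonglongrightarrow> 0" by simp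
    then show "((\<lambda>R::real. 2 * \<tau> (nat \<lfloor>R\<rfloor>) + 2 * \<epsilon> (nat \<lfloor>R\<rfloor>)) \<longlongrightarrow> 0) at_top"
      by (rule filterlim_compose[OF _ fl])
    show "\<forall>\<^sub>F R in at_top. (\<integral>\<^sup>+t. ennreal ((cmod (f R t - F t))\<^sup>2) \<partial>lborel) \<le> 2 * \<tau> (nat \<lfloor>R\<rfloor>) + 2 * \<epsilon> (nat \<lfloor>R\<rfloor>)"
      using eventually_ge_at_top[of 0]
    proof eventually_elim
      fix R :: real assume "0 \<le> R"
      define n where "n = nat \<lfloor>R\<rfloor>"
      have "(\<integral>\<^sup>+t. ennreal ((cmod (f R t - F t))\<^sup>2) \<partial>lborel)
         = (\<integral>\<^sup>+t. ennreal ((cmod ((f R t - f (real n) t) + (f (real n) t - F t)))\<^sup>2) \<partial>lborel)" by simp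
      also have "\<dots> \<le> 2 * (\<integral>\<^sup>+t. ennreal ((cmod (f R t - f (real n) t))\<^sup>2) \<partial>lborel) + 2 * \<epsilon> n"
        unfolding \<epsilon>_def by (rule nn_integral_norm_add_square_le) measurable
      also have "\<dots> \<le> 2 * \<tau> n + 2 * \<epsilon> n"
        using \<open>0 \<le> R\<close> by (intro add_right_mono mult_left_mono diff) (auto simp: n_def)
      finally show "(\<integral>\<^sup>+t. ennreal ((cmod (f R t - F t))\<^sup>2) \<partial>lborel) \<le> 2 * \<tau> (nat \<lfloor>R\<rfloor>) + 2 * \<epsilon> (nat \<lfloor>R\<rfloor>)"
        by (simp add: n_def)
    qed
  qed auto
  ultimately show ?thesis using that[of F r] r ae by (simp add: f_def)
qed

subsection \<open>Entire functions with compactly supported spectrum\<close>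

text \<open>The inversion integral continued to complex arguments; the factor
  \<open>1 / (2 * pi)\<close> enters only when \<open>h\<close> is reconstructed.\<close>

definition spectral_ext :: "(real \<Rightarrow> complex) \<Rightarrow> complex \<Rightarrow> complex" where
  "spectral_ext F w = (LBINT t. F t * exp (- (\<i> * t * w)))"

lemma spectral_ext_of_real: "spectral_ext F (of_real y) = fourier F (- y)"
  by (simp add: spectral_ext_def fourier_def mult_ac)

text \<open>For real \<open>t\<close> the modulus is \<open>exp (t * Im w)\<close>: the half-width
  \<open>T\<close> of the spectrum becomes the exponential type.\<close>

lemma norm_spectral_kernel_le:
  fixes t T :: real
  assumes "\<bar>t\<bar> \<le> T"
  shows "cmod (exp (- (\<i> * of_real t * w))) \<le> exp (T * \<bar>Im w\<bar>)"
proof -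
  have "t * Im w \<le> \<bar>t\<bar> * \<bar>Im w\<bar>" by (metis abs_ge_self abs_mult)
  also have "\<dots> \<le> T * \<bar>Im w\<bar>" using assms by (intro mult_right_mono) auto
  finally show ?thesis by simp
qed

lemma spectral_ext_integrable:
  fixes F :: "real \<Rightarrow> complex" and T :: real
  assumes F: "integrable lborel F" and supp: "\<And>t. \<bar>t\<bar> > T \<Longrightarrow> F t = 0"
  shows "integrable lborel (\<lambda>t. F t * exp (- (\<i> * t * w)))"
proof (rule Bochner_Integration.integrable_bound)
  show "integrable lborel (\<lambda>t. exp (T * \<bar>Im w\<bar>) * cmod (F t))" using F by auto
  have [measurable]: "F \<in> borel_measurable borel" using F by auto
  have [measurable]: "(\<lambda>t::real. exp (- (\<i> * t * w))) \<in> borel_measurable borel"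
    by (intro borel_measurable_continuous_onI continuous_intros)
  show "(\<lambda>t. F t * exp (- (\<i> * t * w))) \<in> borel_measurable lborel" by measurable
  show "AE t in lborel. norm (F t * exp (- (\<i> * t * w))) \<le> norm (exp (T * \<bar>Im w\<bar>) * cmod (F t))"
  proof (rule AE_I2)
    fix t show "norm (F t * exp (- (\<i> * t * w))) \<le> norm (exp (T * \<bar>Im w\<bar>) * cmod (F t))"
    proof (cases "\<bar>t\<bar> \<le> T")
      case True
      from mult_left_mono[OF norm_spectral_kernel_le[OF this, of w] norm_ge_zero[of "F t"]]
      show ?thesis by (simp add: norm_mult mult.commute)
    qed (simp add: supp)
  qed
qed

lemma norm_spectral_ext_le:
  fixes F :: "real \<Rightarrow> complex" and T :: real
  assumes F: "integrable lborel F" and supp: "\<And>t. \<bar>t\<bar> > T \<Longrightarrow> F t = 0"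
  shows "cmod (spectral_ext F w) \<le> (LBINT t. cmod (F t)) * exp (T * \<bar>Im w\<bar>)"
proof -
  have "cmod (spectral_ext F w) \<le> (LBINT t. cmod (F t * exp (- (\<i> * t * w))))"
    unfolding spectral_ext_def by (rule integral_norm_bound)
  also have "\<dots> \<le> (LBINT t. cmod (F t) * exp (T * \<bar>Im w\<bar>))"
  proof (rule integral_mono)
    show "integrable lborel (\<lambda>t. cmod (F t * exp (- (\<i> * t * w))))"
      using spectral_ext_integrable[OF assms] by (intro integrable_norm)
    show "integrable lborel (\<lambda>t. cmod (F t) * exp (T * \<bar>Im w\<bar>))"
      using F by (intro integrable_mult_left integrable_norm)
    show "cmod (F t * exp (- (\<i> * t * w))) \<le> cmod (F t) * exp (T * \<bar>Im w\<bar>)" for t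
    proof (cases "\<bar>t\<bar> \<le> T")
      case True
      from mult_left_mono[OF norm_spectral_kernel_le[OF this, of w] norm_ge_zero[of "F t"]]
      show ?thesis by (simp only: norm_mult)
    qed (simp add: supp)
  qed
  finally show ?thesis by simp
qed

text \<open>The mean value inequality on the disk of radius \<open>cmod z\<close>. The factor
  \<open>cmod z\<close> is there to cancel the increment in a difference quotient.\<close>

lemma norm_exp_minus_1_le: "cmod (exp z - 1) \<le> exp (cmod z) * cmod z"
proof -
  have "cmod (exp z - exp 0) \<le> exp (cmod z) * cmod (z - 0)"
  proof (rule field_differentiable_bound[of "cball 0 (cmod z)"])
    fix w :: complex assume "w \<in> cball 0 (cmod z)"
    then show "norm (exp w) \<le> exp (cmod z)"
      using abs_Re_le_cmod[of w] by simp
  qed (auto intro!: derivative_eq_intros)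
  then show ?thesis by simp
qed

text \<open>Differentiation under the integral sign. The increments form a convergent sequence,
  bounded by some \<open>B\<close>; together with the bounded support of \<open>F\<close> this gives
  the difference quotients a majorant independent of \<open>n\<close>.\<close>

lemma spectral_ext_holomorphic:
  fixes F :: "real \<Rightarrow> complex" and T :: real
  assumes F: "integrable lborel F" and supp: "\<And>t. \<bar>t\<bar> > T \<Longrightarrow> F t = 0"
  shows "spectral_ext F holomorphic_on UNIV"
proof -
  have [measurable]: "F \<in> borel_measurable borel" using F by auto
  have exp_meas [measurable]: "(\<lambda>t::real. exp (- (\<i> * t * w))) \<in> borel_measurable borel" for w
    by (intro borel_measurable_continuous_onI continuous_intros)
  note int = spectral_ext_integrable[OF assms]
  have "\<exists>D. (spectral_ext F has_field_derivative D) (at w)" for w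
  proof (rule exI)
    show "(spectral_ext F has_field_derivative (LBINT t. F t * (- (\<i> * t) * exp (- (\<i> * t * w))))) (at w)"
      unfolding DERIV_def
    proof (subst tendsto_at_iff_sequentially, intro allI impI)
      fix X :: "nat \<Rightarrow> complex"
      assume X: "\<forall>i. X i \<in> UNIV - {0}" and X0: "X \<longlonglongrightarrow> 0"
      from X0 obtain B where B: "\<And>n. cmod (X n) \<le> B"
        using convergent_imp_Bseq[of X] by (auto simp: Bseq_def convergent_def)
      define q where "q = (\<lambda>n t. F t * exp (- (\<i> * of_real t * w)) * ((exp (- (\<i> * of_real t * X n)) - 1) / X n))"
      have "(\<lambda>n. LBINT t. q n t) \<longlonglongrightarrow> (LBINT t. F t * (- (\<i> * t) * exp (- (\<i> * t * w))))"
      proof (rule integral_dominated_convergence[where w = "\<lambda>t. cmod (F t) * (exp (T * \<bar>Im w\<bar>) * (exp (T * B) * T))"])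
        show "integrable lborel (\<lambda>t. cmod (F t) * (exp (T * \<bar>Im w\<bar>) * (exp (T * B) * T)))"
          using F by (intro integrable_mult_left integrable_norm)
        show "AE t in lborel. (\<lambda>n. q n t) \<longlonglongrightarrow> F t * (- (\<i> * t) * exp (- (\<i> * t * w)))"
        proof (rule AE_I2)
          fix t :: real
          have "((\<lambda>z. exp (- (\<i> * t * z))) has_field_derivative - (\<i> * t)) (at 0)"
            by (auto intro!: derivative_eq_intros)
          then have "((\<lambda>z. (exp (- (\<i> * t * z)) - 1) / z) \<longlongrightarrow> - (\<i> * t)) (at 0)"
            by (simp add: DERIV_def)
          then have "(\<lambda>n. (exp (- (\<i> * t * X n)) - 1) / X n) \<longlonglongrightarrow> - (\<i> * t)"
            using X X0 by (auto simp: tendsto_at_iff_sequentially o_def)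
          then have "(\<lambda>n. q n t) \<longlonglongrightarrow> F t * exp (- (\<i> * t * w)) * (- (\<i> * t))"
            unfolding q_def by (intro tendsto_intros)
          then show "(\<lambda>n. q n t) \<longlonglongrightarrow> F t * (- (\<i> * t) * exp (- (\<i> * t * w)))"
            by (simp add: mult_ac)
        qed
        show "AE t in lborel. norm (q n t) \<le> cmod (F t) * (exp (T * \<bar>Im w\<bar>) * (exp (T * B) * T))" for n
        proof (rule AE_I2)
          fix t
          show "norm (q n t) \<le> cmod (F t) * (exp (T * \<bar>Im w\<bar>) * (exp (T * B) * T))"
          proof (cases "\<bar>t\<bar> \<le> T")
            case True
            have tX: "\<bar>t\<bar> * cmod (X n) \<le> T * B"
              using True B[of n] by (intro mult_mono) auto
            have "cmod (exp (- (\<i> * of_real t * X n)) - 1) \<le> exp (\<bar>t\<bar> * cmod (X n)) * (\<bar>t\<bar> * cmod (X n))"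
              using norm_exp_minus_1_le[of "- (\<i> * of_real t * X n)"] by (simp add: norm_mult)
            also have "\<dots> \<le> exp (T * B) * (T * cmod (X n))"
              using True tX by (intro mult_mono mult_right_mono) auto
            finally have "cmod ((exp (- (\<i> * of_real t * X n)) - 1) / X n) \<le> exp (T * B) * T"
              using X by (simp add: norm_divide divide_simps mult_ac)
            then have "norm (q n t) \<le> cmod (F t) * exp (T * \<bar>Im w\<bar>) * (exp (T * B) * T)"
              unfolding q_def norm_mult[of "F t * _"] norm_mult[of "F t"]
              using norm_spectral_kernel_le[OF True, of w] by (intro mult_mono) auto
            then show ?thesis by (simp only: mult.assoc)
          qed (simp add: q_def supp)
        qed
        show "q n \<in> borel_measurable lborel" for n unfolding q_def by measurable
        have [measurable]: "(\<lambda>t::real. - (\<i> * t)) \<in> borel_measurable borel"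
          by (intro borel_measurable_continuous_onI continuous_intros)
        show "(\<lambda>t. F t * (- (\<i> * t) * exp (- (\<i> * t * w)))) \<in> borel_measurable lborel" by measurable
      qed
      moreover have "(LBINT t. q n t) = (spectral_ext F (w + X n) - spectral_ext F w) / X n" for n
      proof -
        have "(LBINT t. q n t) = (LBINT t. (F t * exp (- (\<i> * t * (w + X n))) - F t * exp (- (\<i> * t * w))) / X n)"
          by (intro Bochner_Integration.integral_cong)
            (auto simp: q_def diff_divide_distrib right_diff_distrib ring_distribs exp_diff exp_add exp_minus divide_inverse)
        also have "\<dots> = (spectral_ext F (w + X n) - spectral_ext F w) / X n"
          using int by (simp add: spectral_ext_def)
        finally show ?thesis .
      qed
      ultimately show "((\<lambda>h. (spectral_ext F (w + h) - spectral_ext F w) / h) \<circ> X)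
          \<longlonglongrightarrow> (LBINT t. F t * (- (\<i> * t) * exp (- (\<i> * t * w))))"
        by (simp add: o_def)
    qed
  qed
  then show ?thesis
    unfolding holomorphic_on_def field_differentiable_def by auto
qed

section \<open>Decay in horizontal strips\<close>

text \<open>Only real translations are applied. The growth bound sees just \<open>Im z\<close>, so
  the translates stay uniformly bounded on compact sets, and the heights \<open>v n\<close> remain
  in a compact segment of the imaginary axis, on which uniform convergence to 0 contradicts the
  lower bound \<open>e\<close>.\<close>

lemma entire_L2_decay:
  fixes H :: "complex \<Rightarrow> complex"
  assumes H: "H holomorphic_on UNIV" and bound: "\<And>z. cmod (H z) \<le> C * exp (T * \<bar>Im z\<bar>)"
    and T: "T \<ge> 0"
    and L2: "(\<integral>\<^sup>+y. ennreal ((cmod (H (of_real y)))\<^sup>2) \<partial>lborel) < \<infinity>" and "e > 0"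
  obtains M where "\<And>u v. \<bar>u\<bar> \<ge> M \<Longrightarrow> \<bar>v\<bar> \<le> V \<Longrightarrow> cmod (H (Complex u v)) < e"
proof (rule ccontr)
  assume "\<not> thesis"
  \<comment> \<open>The margin 2 leaves room for the unit interval:
    \<open>\<bar>u n + x\<bar> > n\<close> for every \<open>x\<close> in \<open>[0, 1]\<close>, so
    the translated mass lies in the tail beyond \<open>n\<close>.\<close>
  then have "\<forall>n::nat. \<exists>u v. \<bar>u\<bar> \<ge> real n + 2 \<and> \<bar>v\<bar> \<le> V \<and> e \<le> cmod (H (Complex u v))"
    using that by (metis not_less)
  then obtain u v where uv: "\<And>n::nat. \<bar>u n\<bar> \<ge> real n + 2" "\<And>n. \<bar>v n\<bar> \<le> V" "\<And>n. e \<le> cmod (H (Complex (u n) (v n)))"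
    by metis
  define \<F> where "\<F> = (\<lambda>n z. H (z + of_real (u n)))"
  have C0: "C \<ge> 0" using order_trans[OF norm_ge_zero bound[of 0]] by simp
  have holF: "\<F> n holomorphic_on UNIV" for n
    unfolding \<F>_def by (intro holomorphic_on_compose_gen[OF _ H, unfolded o_def] holomorphic_intros) auto
  obtain g r where g: "g holomorphic_on UNIV" and r: "strict_mono (r :: nat \<Rightarrow> nat)"
    and lim: "\<And>x. x \<in> UNIV \<Longrightarrow> (\<lambda>n. \<F> (r n) x) \<longlonglongrightarrow> g x"
    and unif: "\<And>K. compact K \<Longrightarrow> K \<subseteq> UNIV \<Longrightarrow> uniform_limit K (\<F> \<circ> r) g sequentially"
  proof (rule Montel[of UNIV "range \<F>" \<F>])
    fix K :: "complex set" assume "compact K"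
    then obtain B where B: "\<And>z. z \<in> K \<Longrightarrow> cmod z \<le> B"
      using compact_imp_bounded bounded_iff by metis
    have "cmod (\<F> n z) \<le> C * exp (T * B)" if "z \<in> K" for n z
    proof -
      have "\<bar>Im z\<bar> \<le> B" using abs_Im_le_cmod[of z] B[OF that] by linarith
      then have "C * exp (T * \<bar>Im z\<bar>) \<le> C * exp (T * B)"
        using C0 T by (intro mult_left_mono) (auto intro!: mult_left_mono)
      then show ?thesis using bound[of "z + of_real (u n)"] by (simp add: \<F>_def)
    qed
    then show "\<exists>B. \<forall>h\<in>range \<F>. \<forall>z\<in>K. cmod (h z) \<le> B" by auto
  qed (use holF in auto)
  define h where "h = (\<lambda>y. H (of_real y))"
  have conth: "continuous_on UNIV h"
    unfolding h_def by (intro continuous_on_compose2[OF holomorphic_on_imp_continuous_on[OF H]] continuous_intros) auto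
  have [measurable]: "h \<in> borel_measurable borel" by (rule borel_measurable_continuous_onI[OF conth])
  have contg: "continuous_on UNIV (\<lambda>x::real. g (of_real x))"
    by (intro continuous_on_compose2[OF holomorphic_on_imp_continuous_on[OF g]] continuous_intros) auto
  have [measurable]: "(\<lambda>x::real. g (of_real x)) \<in> borel_measurable borel"
    by (rule borel_measurable_continuous_onI[OF contg])
  define \<tau> where "\<tau> = (\<lambda>n. \<integral>\<^sup>+y. indicator {y. \<bar>y\<bar> > real n} y * ennreal ((cmod (h y))\<^sup>2) \<partial>lborel)"
  have \<tau>: "\<tau> \<longlonglongrightarrow> 0" unfolding \<tau>_def
  proof (rule truncate_tail_tendsto_0)
    show "(\<integral>\<^sup>+y. ennreal ((cmod (h y))\<^sup>2) \<partial>lborel) < \<infinity>" using L2 by (simp add: h_def)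
  qed measurable
  have "(\<integral>\<^sup>+x. indicator {0..1} x * ennreal ((cmod (g (of_real x)))\<^sup>2) \<partial>lborel)
     = (\<integral>\<^sup>+x. liminf (\<lambda>n. indicator {0..1} x * ennreal ((cmod (h (u (r n) + x)))\<^sup>2)) \<partial>lborel)"
  proof (rule nn_integral_cong)
    fix x :: real
    have "(\<lambda>n. h (u (r n) + x)) \<longlonglongrightarrow> g (of_real x)"
      using lim[of "of_real x"] by (simp add: \<F>_def h_def add.commute)
    then have "(\<lambda>n. indicator {0..1} x * ennreal ((cmod (h (u (r n) + x)))\<^sup>2)) \<longlonglongrightarrow> indicator {0..1} x * ennreal ((cmod (g (of_real x)))\<^sup>2)"
      by (intro ennreal_tendsto_cmult tendsto_intros tendsto_ennrealI) (auto simp: indicator_def)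
    then show "indicator {0..1} x * ennreal ((cmod (g (of_real x)))\<^sup>2) = liminf (\<lambda>n. indicator {0..1} x * ennreal ((cmod (h (u (r n) + x)))\<^sup>2))"
      by (metis lim_imp_Liminf sequentially_bot)
  qed
  also have "\<dots> \<le> liminf (\<lambda>n. \<integral>\<^sup>+x. indicator {0..1} x * ennreal ((cmod (h (u (r n) + x)))\<^sup>2) \<partial>lborel)"
    by (rule nn_integral_liminf) measurable
  also have "\<dots> \<le> liminf \<tau>"
  proof (rule Liminf_mono, rule always_eventually, rule allI)
    fix n
    have "(\<integral>\<^sup>+x. indicator {0..1} x * ennreal ((cmod (h (u (r n) + x)))\<^sup>2) \<partial>lborel)
       \<le> (\<integral>\<^sup>+x. indicator {y. \<bar>y\<bar> > real n} (u (r n) + x) * ennreal ((cmod (h (u (r n) + x)))\<^sup>2) \<partial>lborel)"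
      using uv(1)[of "r n"] seq_suble[OF r, of n] by (intro nn_integral_mono) (auto simp: indicator_def)
    also have "\<dots> = \<tau> n"
      unfolding \<tau>_def by (subst (2) nn_integral_real_affine[of _ 1 "u (r n)"]) auto
    finally show "(\<integral>\<^sup>+x. indicator {0..1} x * ennreal ((cmod (h (u (r n) + x)))\<^sup>2) \<partial>lborel) \<le> \<tau> n" .
  qed
  also have "liminf \<tau> = 0" using \<tau> by (metis lim_imp_Liminf sequentially_bot)
  finally have "AE x in lborel. indicator {0..1} x * ennreal ((cmod (g (of_real x)))\<^sup>2) = 0"
    by (subst (asm) le_zero_eq, subst (asm) nn_integral_0_iff_AE) auto
  then have ae: "AE x in lborel. x \<in> {0..1} \<longrightarrow> g (of_real x) = 0"
    by eventually_elim (auto simp: indicator_def)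
  \<comment> \<open>Vanishing almost everywhere on an interval of positive length yields infinitely
    many zeros in a compact set, hence the accumulation point that the identity theorem asks
    for.\<close>
  define A where "A = {x \<in> {0..1::real}. g (of_real x) = 0}"
  have "infinite A"
  proof
    assume "finite A"
    then have "AE x in lborel. x \<notin> A"
      by (intro AE_not_in finite_imp_null_set_lborel)
    with ae have "AE x in lborel. x \<notin> {0..1::real}" by eventually_elim (auto simp: A_def)
    then have "{0..1::real} \<in> null_sets lborel" by (subst AE_iff_null_sets) auto
    then show False by (auto simp: null_sets_def)
  qed
  then have "infinite (complex_of_real ` A)" by (simp add: finite_image_iff inj_on_def)
  moreover have "complex_of_real ` A \<subseteq> cball 0 1" by (auto simp: A_def)
  ultimately obtain \<xi> where "\<xi> islimpt (complex_of_real ` A)"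
    using Heine_Borel_imp_Bolzano_Weierstrass[OF compact_cball] by blast
  then have g0: "g z = 0" for z
    by (rule analytic_continuation[OF g open_UNIV connected_UNIV subset_UNIV UNIV_I]) (auto simp: A_def)
  have "compact (Complex 0 ` {-V..V})"
    unfolding Complex_eq [abs_def] by (intro compact_continuous_image continuous_intros) auto
  from unif[OF this] have "\<forall>\<^sub>F n in sequentially. \<forall>z\<in>Complex 0 ` {-V..V}. cmod (\<F> (r n) z) < e"
    using \<open>e > 0\<close> by (auto simp: uniform_limit_iff g0 o_def)
  then obtain n where n: "\<forall>z\<in>Complex 0 ` {-V..V}. cmod (\<F> (r n) z) < e"
    by (auto simp: eventually_sequentially)
  have "cmod (\<F> (r n) (Complex 0 (v (r n)))) < e"
    using n uv(2)[of "r n"] by (auto simp: abs_le_iff)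
  moreover have "Complex 0 (v (r n)) + of_real (u (r n)) = Complex (u (r n)) (v (r n))"
    by (simp add: complex_eq_iff)
  ultimately show False using uv(3)[of "r n"] by (simp add: \<F>_def)
qed

subsection \<open>Entire functions and branches on the logarithmic surface\<close>

text \<open>The sheet index is a floor, so the strips are closed below and open above: on the line
  \<open>Im w = 2 * pi * k\<close> the value is the boundary value \<open>bplus G k\<close>, through
  the case \<open>\<theta> = 0\<close> of \<open>gpolar\<close>.\<close>

definition entire_of_branches :: "(int \<Rightarrow> complex \<Rightarrow> complex) \<Rightarrow> complex \<Rightarrow> complex" where
  "entire_of_branches G w =
     (let k = \<lfloor>Im w / (2 * pi)\<rfloor> in gpolar G k (exp (Re w)) (Im w - 2 * pi * k))"

lemma entire_of_branches_eq:
  assumes "2 * pi * of_int k \<le> Im w" "Im w < 2 * pi * (of_int k + 1)"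
  shows "entire_of_branches G w = gpolar G k (exp (Re w)) (Im w - 2 * pi * k)"
proof -
  have "\<lfloor>Im w / (2 * pi)\<rfloor> = k"
    using assms by (intro floor_unique) (simp_all add: field_simps)
  then show ?thesis by (simp add: entire_of_branches_def)
qed

lemma exp_polar_shift: "exp w = of_real (exp (Re w)) * exp (\<i> * of_real (Im w - 2 * pi * of_int k))"
proof -
  have "exp w = exp (of_real (Re w) + \<i> * of_real (Im w - 2 * pi * of_int k))"
    unfolding exp_eq by (rule exI[of _ k]) (simp add: complex_eq_iff)
  then show ?thesis by (simp add: exp_add exp_of_real)
qed

lemma floor_strip:
  fixes v :: real
  obtains k :: int where "2 * pi * of_int k \<le> v" "v < 2 * pi * (of_int k + 1)"
proof -
  define k where "k = \<lfloor>v / (2 * pi)\<rfloor>"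
  have "of_int k \<le> v / (2 * pi)" "v / (2 * pi) < of_int k + 1" unfolding k_def by linarith+
  then show ?thesis by (intro that[of k]) (simp_all add: field_simps)
qed

lemma entire_of_branches_interior:
  assumes "2 * pi * of_int k < Im w" "Im w < 2 * pi * (of_int k + 1)"
  shows "entire_of_branches G w = G k (exp w)"
proof -
  have "Im w - 2 * pi * k \<noteq> 0" "Im w - 2 * pi * k \<noteq> 2 * pi" using assms by (auto simp: algebra_simps)
  then show ?thesis
    using assms by (subst entire_of_branches_eq[of k]) (auto simp: gpolar_def exp_polar_shift[of w k])
qed

lemma exp_in_Omega:
  assumes "2 * pi * of_int k < Im w" "Im w < 2 * pi * (of_int k + 1)"
  shows "exp w \<in> Omega"
proof -
  define \<theta> where "\<theta> = Im w - 2 * pi * of_int k"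
  have \<theta>: "0 < \<theta>" "\<theta> < 2 * pi" using assms by (auto simp: \<theta>_def algebra_simps)
  have e: "exp w = of_real (exp (Re w)) * cis \<theta>"
    unfolding cis_conv_exp \<theta>_def by (rule exp_polar_shift)
  have "\<not> (sin \<theta> = 0 \<and> cos \<theta> \<ge> 0)"
  proof
    assume *: "sin \<theta> = 0 \<and> cos \<theta> \<ge> 0"
    then have "cos \<theta> = 1" using sin_cos_squared_add[of \<theta>] by (auto simp: power2_eq_1_iff)
    then obtain n :: int where "\<theta> = n * 2 * pi" by (auto simp: cos_one_2pi_int)
    with \<theta> have "0 < real_of_int n" "real_of_int n < 1" by (auto simp: zero_less_mult_iff)
    then have "0 < n" "n < 1" by simp_all
    then show False by simp
  qed
  then show ?thesis unfolding Omega_def e by (auto simp: zero_le_mult_iff)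
qed

lemma open_Omega: "open Omega"
  unfolding Omega_def
  by (intro open_Compl closed_Collect_conj closed_Collect_eq closed_Collect_le continuous_intros)

text \<open>Within distance \<open>pi / 2\<close> of a cut line the exponential stays in the right
  half-plane, where \<open>psi G k\<close> glues sheet \<open>k\<close> below the positive axis to
  sheet \<open>k + 1\<close> above it. The line itself belongs to strip \<open>k + 1\<close>, while
  \<open>psi\<close> takes \<open>bminus G k\<close> there; the matching condition reconciles the
  two.\<close>

lemma entire_of_branches_near_cut:
  assumes i: "\<And>x. x > 0 \<Longrightarrow> bminus G k x = bplus G (k + 1) x"
    and w: "\<bar>Im w - 2 * pi * (of_int k + 1)\<bar> < pi / 2"
  shows "entire_of_branches G w = psi G k (exp w)" "Re (exp w) > 0"
proof -
  define \<eta> where "\<eta> = Im w - 2 * pi * of_int (k + 1)"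
  have \<eta>: "\<bar>\<eta>\<bar> < pi / 2" using w by (simp add: \<eta>_def)
  have e: "exp w = of_real (exp (Re w)) * cis \<eta>"
    unfolding cis_conv_exp \<eta>_def by (rule exp_polar_shift)
  show "Re (exp w) > 0" unfolding e using \<eta> by (auto intro!: mult_pos_pos cos_gt_zero_pi)
  have Im_e: "Im (exp w) = exp (Re w) * sin \<eta>" unfolding e by simp
  consider "\<eta> < 0" | "\<eta> = 0" | "\<eta> > 0" by linarith
  then show "entire_of_branches G w = psi G k (exp w)"
  proof cases
    case 1
    then have "sin \<eta> < 0" using \<eta> sin_gt_zero[of "- \<eta>"] by auto
    then have "Im (exp w) < 0" unfolding Im_e by (auto simp: mult_less_0_iff)
    moreover have "entire_of_branches G w = G k (exp w)"
      using 1 \<eta> by (intro entire_of_branches_interior) (auto simp: \<eta>_def algebra_simps)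
    ultimately show ?thesis by (simp add: psi_def)
  next
    case 2
    have "entire_of_branches G w = gpolar G (k + 1) (exp (Re w)) \<eta>"
      unfolding \<eta>_def using 2 by (intro entire_of_branches_eq) (auto simp: \<eta>_def algebra_simps)
    then show ?thesis using 2 i[of "exp (Re w)"] by (simp add: e gpolar_def psi_def)
  next
    case 3
    then have "sin \<eta> > 0" using \<eta> sin_gt_zero[of \<eta>] by auto
    then have "Im (exp w) > 0" unfolding Im_e by simp
    moreover have "entire_of_branches G w = G (k + 1) (exp w)"
      using 3 \<eta> by (intro entire_of_branches_interior) (auto simp: \<eta>_def algebra_simps)
    ultimately show ?thesis by (simp add: psi_def)
  qed
qed

text \<open>Condition (ii) speaks only of disks centred on the axis. The disk about \<open>x\<close>
  of radius \<open>x\<close> touches the imaginary axis at 0, and these disks exhaust the half-plane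
  as \<open>x\<close> grows.\<close>

lemma holomorphic_right_half_plane:
  assumes "\<And>x \<rho>. x > 0 \<Longrightarrow> \<rho> > 0 \<Longrightarrow> ball (complex_of_real x) \<rho> \<subseteq> {z. Re z > 0} \<Longrightarrow> f analytic_on ball (complex_of_real x) \<rho>"
  shows "f holomorphic_on {z. Re z > 0}"
proof -
  have sub: "ball (complex_of_real x) x \<subseteq> {z. Re z > 0}" for x
  proof
    fix z assume "z \<in> ball (complex_of_real x) x"
    then have "cmod (of_real x - z) < x" by (simp add: dist_norm)
    then show "z \<in> {z. Re z > 0}" using complex_Re_le_cmod[of "of_real x - z"] by simp
  qed
  have "f holomorphic_on (\<Union>x\<in>{0<..}. ball (complex_of_real x) x)"
    by (intro holomorphic_on_UN_open analytic_imp_holomorphic assms sub) auto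
  moreover have "{z. Re z > 0} \<subseteq> (\<Union>x\<in>{0<..}. ball (complex_of_real x) x)"
  proof
    fix z assume "z \<in> {z. Re z > 0}"
    then have z: "Re z > 0" by simp
    \<comment> \<open>The disk about \<open>x\<close> of radius \<open>x\<close> contains
      \<open>z\<close> exactly when \<open>(cmod z)^2 < 2 * x * Re z\<close>; this \<open>x\<close>
      makes the right side twice the left.\<close>
    define x where "x = (cmod z)\<^sup>2 / Re z"
    have "z \<noteq> 0" using z by auto
    then have x: "x > 0" using z by (simp add: x_def)
    have xz: "x * Re z = (cmod z)\<^sup>2" using z by (simp add: x_def)
    have "(cmod (of_real x - z))\<^sup>2 = x\<^sup>2 - 2 * x * Re z + (cmod z)\<^sup>2"
      unfolding cmod_power2 by (simp add: power2_eq_square algebra_simps)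
    also have "\<dots> < x\<^sup>2" using xz \<open>z \<noteq> 0\<close> by (simp add: mult.assoc)
    finally have "cmod (of_real x - z) < x" using x by (simp add: power2_less_imp_less)
    then show "z \<in> (\<Union>x\<in>{0<..}. ball (complex_of_real x) x)" using x by (auto simp: dist_norm)
  qed
  ultimately show ?thesis by (rule holomorphic_on_subset)
qed

text \<open>Holomorphy is local, and two families of open strips cover the plane: \<open>S k\<close>
  between cut lines, where a single branch is read off, and \<open>N k\<close> around a cut line,
  where \<open>psi\<close> is.\<close>

lemma entire_of_branches_holomorphic:
  assumes hol: "\<And>k. G k analytic_on Omega"
    and i: "\<And>k x. x > 0 \<Longrightarrow> bminus G k x = bplus G (k + 1) x"
    and ii: "\<And>k x \<rho>. x > 0 \<Longrightarrow> \<rho> > 0 \<Longrightarrow> ball (complex_of_real x) \<rho> \<subseteq> {z. Re z > 0} \<Longrightarrow>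
            psi G k analytic_on ball (complex_of_real x) \<rho>"
  shows "entire_of_branches G holomorphic_on UNIV"
proof -
  define S where "S = (\<lambda>k::int. {w. 2 * pi * of_int k < Im w \<and> Im w < 2 * pi * (of_int k + 1)})"
  define N where "N = (\<lambda>k::int. {w. \<bar>Im w - 2 * pi * (of_int k + 1)\<bar> < pi / 2})"
  have opS: "open (S k)" for k unfolding S_def by (intro open_Collect_conj open_Collect_less continuous_intros)
  have opN: "open (N k)" for k unfolding N_def by (intro open_Collect_less continuous_intros)
  have holS: "entire_of_branches G holomorphic_on S k" for k
  proof (rule holomorphic_transform)
    show "(\<lambda>w. G k (exp w)) holomorphic_on S k"
      using exp_in_Omega
      by (intro holomorphic_on_compose_gen[OF _ analytic_imp_holomorphic[OF hol], unfolded o_def] holomorphic_intros)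
        (auto simp: S_def)
  qed (auto simp: S_def entire_of_branches_interior)
  have holN: "entire_of_branches G holomorphic_on N k" for k
  proof (rule holomorphic_transform)
    show "(\<lambda>w. psi G k (exp w)) holomorphic_on N k"
      using entire_of_branches_near_cut(2)[OF i]
      by (intro holomorphic_on_compose_gen[OF _ holomorphic_right_half_plane[OF ii], unfolded o_def] holomorphic_intros)
        (auto simp: N_def)
  qed (auto simp: N_def entire_of_branches_near_cut(1)[OF i])
  have "entire_of_branches G holomorphic_on (\<Union>k. S k) \<union> (\<Union>k. N k)"
    by (intro holomorphic_on_Un holomorphic_on_UN_open holS holN opS opN open_UN ballI)
  moreover have "w \<in> (\<Union>k. S k) \<union> (\<Union>k. N k)" for w
  proof -
    obtain k :: int where k: "2 * pi * of_int k \<le> Im w" "Im w < 2 * pi * (of_int k + 1)" by (rule floor_strip)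
    show ?thesis
    proof (cases "2 * pi * of_int k = Im w")
      case True
      \<comment> \<open>The index drops by one because \<open>N k\<close> surrounds the line at
        height \<open>2 * pi * (k + 1)\<close>.\<close>
      then have "w \<in> N (k - 1)" by (simp add: N_def)
      then show ?thesis by blast
    next
      case False
      then have "w \<in> S k" using k by (simp add: S_def)
      then show ?thesis by blast
    qed
  qed
  then have "(\<Union>k. S k) \<union> (\<Union>k. N k) = UNIV" by blast
  ultimately show ?thesis by simp
qed

lemma norm_entire_of_branches_le:
  assumes "\<And>k r \<theta>. r > 0 \<Longrightarrow> 0 \<le> \<theta> \<Longrightarrow> \<theta> \<le> 2 * pi \<Longrightarrow>
            cmod (gpolar G k r \<theta>) \<le> C * exp (T * \<bar>2 * pi * of_int k + \<theta>\<bar>)"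
  shows "cmod (entire_of_branches G w) \<le> C * exp (T * \<bar>Im w\<bar>)"
proof -
  obtain k :: int where k: "2 * pi * of_int k \<le> Im w" "Im w < 2 * pi * (of_int k + 1)" by (rule floor_strip)
  show ?thesis
    using assms[of "exp (Re w)" "Im w - 2 * pi * of_int k" k] k
    by (simp add: entire_of_branches_eq[OF k] algebra_simps)
qed

lemma entire_of_branches_tendsto_0:
  assumes "\<And>k. uniform_limit {0..2*pi} (\<lambda>r \<theta>. gpolar G k r \<theta>) (\<lambda>_. 0) (at_right 0)"
    and "\<And>k. uniform_limit {0..2*pi} (\<lambda>r \<theta>. gpolar G k r \<theta>) (\<lambda>_. 0) at_top"
  shows "((\<lambda>u. entire_of_branches G (Complex u v)) \<longlongrightarrow> 0) at_bot"
    and "((\<lambda>u. entire_of_branches G (Complex u v)) \<longlongrightarrow> 0) at_top"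
proof -
  obtain k :: int where k: "2 * pi * of_int k \<le> v" "v < 2 * pi * (of_int k + 1)" by (rule floor_strip)
  have eq: "entire_of_branches G (Complex u v) = gpolar G k (exp u) (v - 2 * pi * k)" for u
    using entire_of_branches_eq[of k "Complex u v"] k by simp
  have mem: "v - 2 * pi * k \<in> {0..2*pi}" using k by (simp add: algebra_simps)
  have e: "filterlim exp (at_right (0::real)) at_bot"
    by (auto simp: filterlim_at exp_at_bot)
  show "((\<lambda>u. entire_of_branches G (Complex u v)) \<longlongrightarrow> 0) at_bot"
    unfolding eq by (rule filterlim_compose[OF tendsto_uniform_limitI[OF assms(1) mem] e])
  show "((\<lambda>u. entire_of_branches G (Complex u v)) \<longlongrightarrow> 0) at_top"
    unfolding eq by (rule filterlim_compose[OF tendsto_uniform_limitI[OF assms(2) mem] exp_at_top])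
qed

lemma entire_of_branches_of_real: "entire_of_branches G (of_real y) = bplus G 0 (exp y)"
  using entire_of_branches_eq[of 0 "of_real y"] by (simp add: gpolar_def)

section \<open>From an entire function back to branches\<close>

text \<open>\<open>Ln\<close> is cut along the negative axis, so \<open>Ln (- z)\<close> is cut
  along the positive one and is holomorphic on \<open>Omega\<close>. Its imaginary part is the angle
  in \<open>(0, 2 * pi)\<close> minus \<open>pi\<close>; adding \<open>pi * (2 * k + 1)\<close>
  gives the angles of sheet \<open>k\<close>.\<close>

definition branches_of_entire :: "(complex \<Rightarrow> complex) \<Rightarrow> int \<Rightarrow> complex \<Rightarrow> complex" where
  "branches_of_entire H k z = H (Ln (- z) + \<i> * (pi * (2 * k + 1)))"

text \<open>\<open>Ln (- z)\<close> jumps across the positive axis, whereas \<open>Ln z\<close> is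
  continuous there, so this form and its counterpart below the axis give the boundary limits. Below
  the axis \<open>Ln z\<close> has a negative angle, hence the shift by
  \<open>k + 1\<close>.\<close>

lemma branches_of_entire_upper:
  assumes "Im z > 0" shows "branches_of_entire H k z = H (Ln z + \<i> * (2 * pi * k))"
proof -
  have "Ln (- z) = Ln z - \<i> * pi" using assms by (subst Ln_minus) auto
  then show ?thesis unfolding branches_of_entire_def by (simp only:) (simp add: algebra_simps)
qed

lemma branches_of_entire_lower:
  assumes "Im z < 0" shows "branches_of_entire H k z = H (Ln z + \<i> * (2 * pi * (k + 1)))"
proof -
  have "Ln (- z) = Ln z + \<i> * pi" using assms by (subst Ln_minus) auto
  then show ?thesis unfolding branches_of_entire_def by (simp only:) (simp add: algebra_simps)
qed

lemma branches_of_entire_polar: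
  assumes "r > 0" "0 < \<theta>" "\<theta> < 2 * pi"
  shows "branches_of_entire H k (of_real r * exp (\<i> * of_real \<theta>)) = H (Complex (ln r) (2 * pi * k + \<theta>))"
proof -
  have "Ln (- (of_real r * exp (\<i> * of_real \<theta>))) = Complex (ln r) (\<theta> - pi)"
  proof (rule Ln_unique)
    have "exp (Complex (ln r) (\<theta> - pi)) = of_real r * cis (\<theta> - pi)"
      using assms by (simp add: exp_eq_polar)
    also have "cis (\<theta> - pi) = - exp (\<i> * of_real \<theta>)"
      by (simp add: complex_eq_iff flip: cis_conv_exp)
    finally show "exp (Complex (ln r) (\<theta> - pi)) = - (of_real r * exp (\<i> * of_real \<theta>))" by simp
  qed (use assms in auto)
  moreover have "Complex (ln r) (\<theta> - pi) + \<i> * (pi * (2 * of_int k + 1)) = Complex (ln r) (2 * pi * of_int k + \<theta>)"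
    by (simp add: complex_eq_iff algebra_simps)
  ultimately show ?thesis by (simp add: branches_of_entire_def)
qed

context
  fixes H :: "complex \<Rightarrow> complex"
  assumes H: "H holomorphic_on UNIV"
begin

lemma branches_of_entire_analytic: "branches_of_entire H k analytic_on Omega"
proof -
  have "branches_of_entire H k holomorphic_on Omega"
    unfolding branches_of_entire_def [abs_def]
    by (intro holomorphic_on_compose_gen[OF _ H, unfolded o_def] holomorphic_intros)
      (auto simp: Omega_def complex_nonpos_Reals_iff)
  then show ?thesis by (simp add: analytic_on_open open_Omega)
qed

text \<open>The approach \<open>\<gamma>\<close> and the filter are arbitrary so that limits from
  above and from below are both covered.\<close>

lemma entire_at_branch_tendsto:
  assumes "x > 0" and "(\<gamma> \<longlongrightarrow> complex_of_real x) F"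
  shows "((\<lambda>\<epsilon>. H (Ln (\<gamma> \<epsilon>) + \<i> * (2 * pi * of_int k))) \<longlongrightarrow> H (Complex (ln x) (2 * pi * of_int k))) F"
proof -
  have "isCont H w" for w
    using holomorphic_on_imp_continuous_on[OF H] by (simp add: continuous_on_eq_continuous_at)
  moreover have "((\<lambda>\<epsilon>. Ln (\<gamma> \<epsilon>) + \<i> * (2 * pi * of_int k)) \<longlongrightarrow> Ln (of_real x) + \<i> * (2 * pi * of_int k)) F"
    using assms by (intro tendsto_intros) (auto simp: complex_nonpos_Reals_iff)
  moreover have "Ln (of_real x) + \<i> * (2 * pi * of_int k) = Complex (ln x) (2 * pi * of_int k)"
    using assms by (simp add: Ln_of_real complex_eq_iff)
  ultimately show ?thesis by (metis isCont_tendsto_compose)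
qed

lemma branches_of_entire_tendsto_upper:
  assumes "x > 0"
  shows "((\<lambda>\<epsilon>::real. branches_of_entire H k (complex_of_real x + \<i> * complex_of_real \<epsilon>))
           \<longlongrightarrow> H (Complex (ln x) (2 * pi * of_int k))) (at_right 0)"
proof (rule Lim_transform_eventually)
  have "((\<lambda>\<epsilon>::real. complex_of_real x + \<i> * complex_of_real \<epsilon>) \<longlongrightarrow> complex_of_real x + \<i> * of_real 0) (at_right 0)"
    by (intro tendsto_intros)
  then show "((\<lambda>\<epsilon>::real. H (Ln (complex_of_real x + \<i> * complex_of_real \<epsilon>) + \<i> * (2 * pi * of_int k)))
           \<longlongrightarrow> H (Complex (ln x) (2 * pi * of_int k))) (at_right 0)"
    by (intro entire_at_branch_tendsto[OF assms]) simp
  show "\<forall>\<^sub>F \<epsilon>::real in at_right 0. H (Ln (complex_of_real x + \<i> * complex_of_real \<epsilon>) + \<i> * (2 * pi * of_int k))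
     = branches_of_entire H k (complex_of_real x + \<i> * complex_of_real \<epsilon>)"
    using eventually_at_right_less[of "0::real"] by eventually_elim (simp add: branches_of_entire_upper)
qed

lemma branches_of_entire_tendsto_lower:
  assumes "x > 0"
  shows "((\<lambda>\<epsilon>::real. branches_of_entire H k (complex_of_real x - \<i> * complex_of_real \<epsilon>))
           \<longlongrightarrow> H (Complex (ln x) (2 * pi * of_int (k + 1)))) (at_right 0)"
proof (rule Lim_transform_eventually)
  have "((\<lambda>\<epsilon>::real. complex_of_real x - \<i> * complex_of_real \<epsilon>) \<longlongrightarrow> complex_of_real x - \<i> * of_real 0) (at_right 0)"
    by (intro tendsto_intros)
  then show "((\<lambda>\<epsilon>::real. H (Ln (complex_of_real x - \<i> * complex_of_real \<epsilon>) + \<i> * (2 * pi * of_int (k + 1))))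
           \<longlongrightarrow> H (Complex (ln x) (2 * pi * of_int (k + 1)))) (at_right 0)"
    by (intro entire_at_branch_tendsto[OF assms]) simp
  show "\<forall>\<^sub>F \<epsilon>::real in at_right 0. H (Ln (complex_of_real x - \<i> * complex_of_real \<epsilon>) + \<i> * (2 * pi * of_int (k + 1)))
     = branches_of_entire H k (complex_of_real x - \<i> * complex_of_real \<epsilon>)"
    using eventually_at_right_less[of "0::real"] by eventually_elim (simp add: branches_of_entire_lower)
qed

lemma bplus_branches_of_entire:
  "x > 0 \<Longrightarrow> bplus (branches_of_entire H) k x = H (Complex (ln x) (2 * pi * of_int k))"
  unfolding bplus_def by (intro tendsto_Lim branches_of_entire_tendsto_upper) auto

lemma bminus_branches_of_entire:
  "x > 0 \<Longrightarrow> bminus (branches_of_entire H) k x = H (Complex (ln x) (2 * pi * of_int (k + 1)))"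
  unfolding bminus_def by (intro tendsto_Lim branches_of_entire_tendsto_lower) auto

text \<open>The three cases of \<open>psi\<close> collapse into one formula because the lower half
  of sheet \<open>k\<close> and the upper half of sheet \<open>k + 1\<close> carry the same shift of
  \<open>Ln\<close>. Condition (ii) thereby becomes holomorphy of a composition.\<close>

lemma psi_branches_of_entire:
  assumes "Re z > 0"
  shows "psi (branches_of_entire H) k z = H (Ln z + \<i> * (2 * pi * of_int (k + 1)))"
proof -
  consider "Im z < 0" | "Im z = 0" | "Im z > 0" by linarith
  then show ?thesis
  proof cases
    case 2
    then have "of_real (Re z) = z" by (simp add: complex_eq_iff)
    then have "Ln z = of_real (ln (Re z))" using assms Ln_of_real[of "Re z"] by simp
    then have "Ln z + \<i> * (2 * pi * of_int (k + 1)) = Complex (ln (Re z)) (2 * pi * of_int (k + 1))"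
      by (simp add: complex_eq_iff)
    then show ?thesis using 2 assms by (simp add: psi_def bminus_branches_of_entire)
  qed (auto simp: psi_def branches_of_entire_lower branches_of_entire_upper)
qed

lemma psi_branches_of_entire_analytic:
  assumes "ball x \<rho> \<subseteq> {z. Re z > 0}"
  shows "psi (branches_of_entire H) k analytic_on ball x \<rho>"
proof -
  have "(\<lambda>z. H (Ln z + \<i> * (2 * pi * of_int (k + 1)))) holomorphic_on ball x \<rho>"
    using assms
    by (intro holomorphic_on_compose_gen[OF _ H, unfolded o_def] holomorphic_intros)
      (auto simp: complex_nonpos_Reals_iff dest!: subsetD)
  then have "psi (branches_of_entire H) k holomorphic_on ball x \<rho>"
    by (rule holomorphic_transform) (use assms in \<open>auto simp: psi_branches_of_entire\<close>)
  then show ?thesis by (simp add: analytic_on_open)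
qed

lemma gpolar_branches_of_entire:
  assumes "r > 0" "0 \<le> \<theta>" "\<theta> \<le> 2 * pi"
  shows "gpolar (branches_of_entire H) k r \<theta> = H (Complex (ln r) (2 * pi * of_int k + \<theta>))"
  using assms branches_of_entire_polar[of r \<theta> H k]
  by (auto simp: gpolar_def bplus_branches_of_entire bminus_branches_of_entire algebra_simps)

lemma uniform_limit_branches_of_entire:
  assumes decay: "\<And>V e. e > 0 \<Longrightarrow> \<exists>M. \<forall>u v. \<bar>u\<bar> \<ge> M \<longrightarrow> \<bar>v\<bar> \<le> V \<longrightarrow> cmod (H (Complex u v)) < e"
  shows "uniform_limit {0..2*pi} (\<lambda>r \<theta>. gpolar (branches_of_entire H) k r \<theta>) (\<lambda>_. 0) (at_right 0)"
    and "uniform_limit {0..2*pi} (\<lambda>r \<theta>. gpolar (branches_of_entire H) k r \<theta>) (\<lambda>_. 0) at_top"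
proof -
  \<comment> \<open>Bounds the height \<open>2 * pi * k + \<theta>\<close> over all of sheet
    \<open>k\<close>, so decay in a single strip is uniform in \<open>\<theta>\<close>.\<close>
  define V where "V = 2 * pi * \<bar>of_int k\<bar> + 2 * pi"
  have V: "\<bar>2 * pi * of_int k + \<theta>\<bar> \<le> V" if "\<theta> \<in> {0..2*pi}" for \<theta>
    using that abs_triangle_ineq[of "2 * pi * of_int k" \<theta>] by (auto simp: V_def abs_mult)
  have *: "\<forall>\<theta>\<in>{0..2*pi}. dist (gpolar (branches_of_entire H) k r \<theta>) 0 < e"
    if "\<forall>u v. \<bar>u\<bar> \<ge> M \<longrightarrow> \<bar>v\<bar> \<le> V \<longrightarrow> cmod (H (Complex u v)) < e" "r > 0" "\<bar>ln r\<bar> \<ge> M" for M e r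
    using that V by (auto simp: gpolar_branches_of_entire)
  show "uniform_limit {0..2*pi} (\<lambda>r \<theta>. gpolar (branches_of_entire H) k r \<theta>) (\<lambda>_. 0) (at_right 0)"
  proof (rule uniform_limitI)
    fix e :: real assume "e > 0"
    from decay[OF this, of V] obtain M where M: "\<forall>u v. \<bar>u\<bar> \<ge> M \<longrightarrow> \<bar>v\<bar> \<le> V \<longrightarrow> cmod (H (Complex u v)) < e" by blast
    have "\<forall>\<^sub>F r::real in at_right 0. ln r \<le> - M"
      using ln_at_0 by (simp add: filterlim_at_bot)
    with eventually_at_right_less[of "0::real"]
    show "\<forall>\<^sub>F r in at_right 0. \<forall>\<theta>\<in>{0..2*pi}. dist (gpolar (branches_of_entire H) k r \<theta>) 0 < e"
      by eventually_elim (rule *[OF M], auto)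
  qed
  show "uniform_limit {0..2*pi} (\<lambda>r \<theta>. gpolar (branches_of_entire H) k r \<theta>) (\<lambda>_. 0) at_top"
  proof (rule uniform_limitI)
    fix e :: real assume "e > 0"
    from decay[OF this, of V] obtain M where M: "\<forall>u v. \<bar>u\<bar> \<ge> M \<longrightarrow> \<bar>v\<bar> \<le> V \<longrightarrow> cmod (H (Complex u v)) < e" by blast
    have "\<forall>\<^sub>F r::real in at_top. ln r \<ge> M"
      using ln_at_top by (simp add: filterlim_at_top)
    with eventually_gt_at_top[of "0::real"]
    show "\<forall>\<^sub>F r in at_top. \<forall>\<theta>\<in>{0..2*pi}. dist (gpolar (branches_of_entire H) k r \<theta>) 0 < e"
      by eventually_elim (rule *[OF M], auto)
  qed
qed

end

subsection \<open>Logarithmic substitution and the theorem\<close>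

definition exp_pullback :: "real \<Rightarrow> (real \<Rightarrow> complex) \<Rightarrow> real \<Rightarrow> complex" where
  "exp_pullback c f y = complex_of_real (exp (c * y)) * f (exp y)"

lemma exp_pullback_continuous:
  assumes "continuous_on {0<..} f"
  shows "continuous_on UNIV (exp_pullback c f)"
  unfolding exp_pullback_def [abs_def]
  by (intro continuous_intros continuous_on_compose2[OF assms]) auto

lemma exp_pullback_eq: "x > 0 \<Longrightarrow> exp_pullback c f (ln x) = complex_of_real (x powr c) * f x"
  by (simp add: exp_pullback_def powr_def mult.commute)

text \<open>Under \<open>x = exp y\<close> the squared weight \<open>x powr (2 * c - 1)\<close>
  times the Jacobian \<open>exp y\<close> is \<open>exp (2 * c * y)\<close>: the \<open>1/2\<close>
  in the weight absorbs the Jacobian. The substitution is made on \<open>[-n, n]\<close>, where the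
  integrand is continuous, and Fatou's lemma passes to the whole line.\<close>

lemma exp_pullback_L2:
  assumes f: "f \<in> X2 c" and cont: "continuous_on {0<..} f"
  shows "(\<integral>\<^sup>+y. ennreal ((cmod (exp_pullback c f y))\<^sup>2) \<partial>lborel) < \<infinity>"
proof -
  define q where "q = (\<lambda>x. (cmod (f x) * x powr (c - 1/2))\<^sup>2)"
  have q_exp: "q (exp y) * exp y = (cmod (exp_pullback c f y))\<^sup>2" for y
  proof -
    have "((exp y) powr (c - 1/2))\<^sup>2 * exp y = (exp (c * y))\<^sup>2"
      by (simp add: powr_def power2_eq_square mult_exp_exp algebra_simps)
    then show ?thesis
      by (simp add: q_def exp_pullback_def norm_mult power_mult_distrib mult_ac)
  qed
  define I where "I = (\<integral>\<^sup>+x. indicator {0<..} x * ennreal (q x) \<partial>lborel)"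
  have I: "I < \<infinity>"
    using f by (simp add: X2_def I_def q_def nn_integral_completion)
  have [measurable]: "exp_pullback c f \<in> borel_measurable borel"
    by (rule borel_measurable_continuous_onI[OF exp_pullback_continuous[OF cont]])
  have step: "(\<integral>\<^sup>+y. ennreal ((cmod (exp_pullback c f y))\<^sup>2) * indicator {- real n..real n} y \<partial>lborel) \<le> I" for n
  proof -
    have contq: "continuous_on {exp (- real n)..exp (real n)} q"
      unfolding q_def
      by (intro continuous_intros continuous_on_subset[OF cont]) (auto intro: less_le_trans[OF exp_gt_zero])
    have "(\<integral>\<^sup>+x. ennreal (q x * indicator {exp (- real n)..exp (real n)} x) \<partial>lborel) =
       (\<integral>\<^sup>+y. ennreal (q (exp y) * exp y * indicator {- real n..real n} y) \<partial>lborel)"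
    proof (rule nn_integral_substitution)
      show "set_borel_measurable borel {exp (- real n)..exp (real n)} q"
        unfolding set_borel_measurable_def by (intro borel_measurable_continuous_on_indicator contq) auto
    qed (auto intro!: derivative_eq_intros continuous_intros)
    also have "\<dots> = (\<integral>\<^sup>+y. ennreal ((cmod (exp_pullback c f y))\<^sup>2) * indicator {- real n..real n} y \<partial>lborel)"
      unfolding q_exp by (intro nn_integral_cong) (auto simp: indicator_def)
    finally have "(\<integral>\<^sup>+y. ennreal ((cmod (exp_pullback c f y))\<^sup>2) * indicator {- real n..real n} y \<partial>lborel)
       = (\<integral>\<^sup>+x. ennreal (q x * indicator {exp (- real n)..exp (real n)} x) \<partial>lborel)" by simp
    also have "\<dots> \<le> I"
      unfolding I_def by (intro nn_integral_mono) (auto simp: indicator_def intro: less_le_trans[OF exp_gt_zero])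
    finally show ?thesis .
  qed
  have "(\<integral>\<^sup>+y. ennreal ((cmod (exp_pullback c f y))\<^sup>2) \<partial>lborel)
     = (\<integral>\<^sup>+y. liminf (\<lambda>n. ennreal ((cmod (exp_pullback c f y))\<^sup>2) * indicator {- real n..real n} y) \<partial>lborel)"
  proof (rule nn_integral_cong)
    fix y :: real
    have "\<forall>\<^sub>F n in sequentially. \<bar>y\<bar> \<le> real n" by real_asymp
    then have "\<forall>\<^sub>F n in sequentially. ennreal ((cmod (exp_pullback c f y))\<^sup>2)
       = ennreal ((cmod (exp_pullback c f y))\<^sup>2) * indicator {- real n..real n} y"
      by eventually_elim (simp add: indicator_def abs_le_iff)
    then have "(\<lambda>n. ennreal ((cmod (exp_pullback c f y))\<^sup>2) * indicator {- real n..real n} y)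
       \<longlonglongrightarrow> ennreal ((cmod (exp_pullback c f y))\<^sup>2)"
      by (rule Lim_transform_eventually[OF tendsto_const])
    then show "ennreal ((cmod (exp_pullback c f y))\<^sup>2)
      = liminf (\<lambda>n. ennreal ((cmod (exp_pullback c f y))\<^sup>2) * indicator {- real n..real n} y)"
      by (metis lim_imp_Liminf sequentially_bot)
  qed
  also have "\<dots> \<le> liminf (\<lambda>n. \<integral>\<^sup>+y. ennreal ((cmod (exp_pullback c f y))\<^sup>2) * indicator {- real n..real n} y \<partial>lborel)"
    by (rule nn_integral_liminf) measurable
  also have "\<dots> \<le> I"
    by (rule Liminf_le) (auto intro!: step always_eventually)
  finally show ?thesis using I by (rule le_less_trans)
qed

text \<open>The kernel \<open>u powr (c + \<i> * t - 1)\<close> times the Jacobian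
  \<open>exp y\<close> is \<open>exp (c * y) * iexp (t * y)\<close>, and the window
  \<open>{1/\<rho>..\<rho>}\<close> becomes symmetric about 0. Continuity on the compact window
  permits the passage from the completed measure to the Borel one.\<close>

lemma mellin_trunc_eq_fourier:
  assumes cont: "continuous_on {0<..} f" and "\<rho> \<ge> 1"
  shows "mellin_trunc c f \<rho> t = fourier (truncate (ln \<rho>) (exp_pullback c f)) t"
proof -
  define \<phi> where "\<phi> = (\<lambda>u. f u * (complex_of_real u) powr (complex_of_real c + \<i> * complex_of_real t - 1))"
  have pos: "u > 0" if "u \<in> {1/\<rho>..\<rho>}" for u
    using that \<open>\<rho> \<ge> 1\<close> less_le_trans[of 0 "1/\<rho>" u] by auto
  have cont\<phi>: "continuous_on {1/\<rho>..\<rho>} \<phi>"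
    unfolding \<phi>_def using pos
    by (intro continuous_intros continuous_on_subset[OF cont]) (force simp: complex_nonpos_Reals_iff)+
  have l: "ln (1/\<rho>) = - ln \<rho>" "0 \<le> ln \<rho>" using \<open>\<rho> \<ge> 1\<close> by (simp_all add: ln_div)
  have ex: "exp (- ln \<rho>) = 1/\<rho>" "exp (ln \<rho>) = \<rho>" using \<open>\<rho> \<ge> 1\<close> by (simp_all add: exp_minus divide_inverse)
  have "mellin_trunc c f \<rho> t = (LINT u|lebesgue. indicator {1/\<rho>..\<rho>} u *\<^sub>R \<phi> u)"
    by (simp add: mellin_trunc_def set_lebesgue_integral_def \<phi>_def)
  also have "\<dots> = (LBINT u : {1/\<rho>..\<rho>}. \<phi> u)"
    unfolding set_lebesgue_integral_def
    by (rule integral_completion) (use borel_measurable_continuous_on_indicator[OF _ cont\<phi>] in simp)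
  also have "\<dots> = (LBINT u=1/\<rho>..\<rho>. \<phi> u)"
    using \<open>\<rho> \<ge> 1\<close> by (intro interval_integral_Icc[symmetric]) (simp add: divide_le_eq order_trans[of 1 \<rho> "\<rho> * \<rho>"])
  also have "\<dots> = (LBINT y=- ln \<rho>..ln \<rho>. exp y *\<^sub>R \<phi> (exp y))"
  proof -
    have "exp ` {- ln \<rho>..ln \<rho>} \<subseteq> {exp (- ln \<rho>)..exp (ln \<rho>)}"
      unfolding image_subset_iff by simp
    then have "exp ` {- ln \<rho>..ln \<rho>} \<subseteq> {1/\<rho>..\<rho>}" unfolding ex .
    then have "(LBINT y=- ln \<rho>..ln \<rho>. exp y *\<^sub>R \<phi> (exp y)) = (LBINT u=exp (- ln \<rho>)..exp (ln \<rho>). \<phi> u)"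
      using l by (intro interval_integral_substitution_finite continuous_on_subset[OF cont\<phi>])
        (auto intro!: derivative_eq_intros continuous_intros)
    then show ?thesis unfolding ex by simp
  qed
  also have "\<dots> = (LBINT y : {- ln \<rho>..ln \<rho>}. exp y *\<^sub>R \<phi> (exp y))"
    using l by (intro interval_integral_Icc) simp
  also have "\<dots> = fourier (truncate (ln \<rho>) (exp_pullback c f)) t"
    unfolding set_lebesgue_integral_def fourier_def truncate_def
  proof (intro Bochner_Integration.integral_cong refl)
    fix y :: real
    have "(complex_of_real (exp y)) powr (complex_of_real c + \<i> * complex_of_real t - 1)
      = exp ((complex_of_real c + \<i> * complex_of_real t - 1) * of_real y)"
      by (simp add: powr_def Ln_of_real)
    then have "exp y *\<^sub>R \<phi> (exp y)
      = f (exp y) * (exp (complex_of_real y) * exp ((complex_of_real c + \<i> * complex_of_real t - 1) * of_real y))"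
      by (simp add: \<phi>_def scaleR_conv_of_real exp_of_real)
    also have "exp (complex_of_real y) * exp ((complex_of_real c + \<i> * complex_of_real t - 1) * of_real y)
      = exp (complex_of_real (c * y)) * iexp (t * y)"
      unfolding exp_add[symmetric] by (rule arg_cong[of _ _ exp]) (simp add: algebra_simps)
    finally have "exp y *\<^sub>R \<phi> (exp y) = exp_pullback c f y * iexp (t * y)"
      unfolding exp_of_real exp_pullback_def by (simp only: mult_ac)
    then show "indicator {- ln \<rho>..ln \<rho>} y *\<^sub>R (exp y *\<^sub>R \<phi> (exp y)) =
         indicator {- ln \<rho>..ln \<rho>} y *\<^sub>R exp_pullback c f y * iexp (t * y)"
      by simp
  qed
  finally show ?thesis .
qed

text \<open>The parameters correspond by \<open>R = ln \<rho>\<close>. Allowing \<open>F'\<close> to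
  differ from \<open>F\<close> on a null set lets a Lebesgue measurable spectrum be exchanged for a
  Borel one of the desired support.\<close>

lemma mellin_L2_limit_iff:
  assumes cont: "continuous_on {0<..} f" and F: "AE t in lborel. F t = F' t"
  shows "((\<lambda>\<rho>. \<integral>\<^sup>+t. ennreal ((cmod (mellin_trunc c f \<rho> t - F t))\<^sup>2) \<partial>lebesgue) \<longlongrightarrow> 0) at_top \<longleftrightarrow>
    ((\<lambda>R. \<integral>\<^sup>+t. ennreal ((cmod (fourier (truncate R (exp_pullback c f)) t - F' t))\<^sup>2) \<partial>lborel) \<longlongrightarrow> 0) at_top"
    (is "(?A \<longlongrightarrow> 0) at_top \<longleftrightarrow> (?B \<longlongrightarrow> 0) at_top")
proof -
  have eq: "?A \<rho> = ?B (ln \<rho>)" if "\<rho> \<ge> 1" for \<rho>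
    unfolding mellin_trunc_eq_fourier[OF cont that] nn_integral_completion
    using F by (intro nn_integral_cong_AE) (auto elim: eventually_mono)
  show ?thesis
  proof
    assume "(?A \<longlongrightarrow> 0) at_top"
    then have "((\<lambda>R. ?A (exp R)) \<longlongrightarrow> 0) at_top"
      by (rule filterlim_compose[OF _ exp_at_top])
    moreover have "\<forall>\<^sub>F R in at_top. ?A (exp R) = ?B R"
      using eventually_ge_at_top[of 0] by eventually_elim (simp add: eq)
    ultimately show "(?B \<longlongrightarrow> 0) at_top" by (rule Lim_transform_eventually)
  next
    assume "(?B \<longlongrightarrow> 0) at_top"
    then have "((\<lambda>\<rho>. ?B (ln \<rho>)) \<longlongrightarrow> 0) at_top"
      by (rule filterlim_compose[OF _ ln_at_top])
    moreover have "\<forall>\<^sub>F \<rho> in at_top. ?B (ln \<rho>) = ?A \<rho>"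
      using eventually_ge_at_top[of 1] by eventually_elim (simp add: eq)
    ultimately show "(?A \<longlongrightarrow> 0) at_top" by (rule Lim_transform_eventually)
  qed
qed

lemma lebesgue_ex_borel_complex:
  fixes F :: "real \<Rightarrow> complex"
  assumes [measurable]: "F \<in> borel_measurable lebesgue"
  obtains F' where "F' \<in> borel_measurable borel" "AE t in lborel. F t = F' t"
proof -
  obtain g where g: "g \<in> borel_measurable lborel" "AE t in lborel. Re (F t) = g t"
    using completion_ex_borel_measurable_real[of "\<lambda>t. Re (F t)" lborel] by auto
  obtain h where h: "h \<in> borel_measurable lborel" "AE t in lborel. Im (F t) = h t"
    using completion_ex_borel_measurable_real[of "\<lambda>t. Im (F t)" lborel] by auto
  show ?thesis
  proof (rule that)
    have [measurable]: "g \<in> borel_measurable borel" "h \<in> borel_measurable borel" using g h by simp_all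
    show "(\<lambda>t. complex_of_real (g t) + \<i> * complex_of_real (h t)) \<in> borel_measurable borel" by measurable
    show "AE t in lborel. F t = complex_of_real (g t) + \<i> * complex_of_real (h t)"
      using g(2) h(2) by eventually_elim (simp add: complex_eq_iff)
  qed
qed

section \<open>The two inclusions\<close>

text \<open>Continuity of \<open>f\<close> is part of the conclusion and is read off from
  \<open>f x = x powr (- c) * H (ln x)\<close>. Afterwards two limits of the same truncated
  transforms meet: \<open>F t\<close> along \<open>r\<close> for almost every \<open>t\<close>, and
  0 for every \<open>t\<close> with \<open>\<bar>t\<bar> > T\<close>.\<close>

lemma MB2_subset_B2:
  assumes "f \<in> MB2 c T"
  shows "f \<in> B2 c T"
proof -
  have X: "f \<in> X2 c" using assms by (simp add: MB2_def)
  obtain G :: "int \<Rightarrow> complex \<Rightarrow> complex" and C where hol': "\<forall>k. G k analytic_on Omega"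
    and i': "\<forall>k. \<forall>x>0.
            (\<exists>l. ((\<lambda>\<epsilon>::real. G k (complex_of_real x + \<i> * complex_of_real \<epsilon>)) \<longlongrightarrow> l) (at_right 0)) \<and>
            (\<exists>l. ((\<lambda>\<epsilon>::real. G k (complex_of_real x - \<i> * complex_of_real \<epsilon>)) \<longlongrightarrow> l) (at_right 0)) \<and>
            bminus G k x = bplus G (k + 1) x"
    and i0': "\<forall>x>0. bplus G 0 x = complex_of_real (x powr c) * f x"
    and ii': "\<forall>k. \<forall>x>0. \<forall>\<rho>>0. ball (complex_of_real x) \<rho> \<subseteq> {z. Re z > 0} \<longrightarrow>
            psi G k analytic_on ball (complex_of_real x) \<rho>"
    and iii: "\<forall>k r \<theta>. r > 0 \<and> 0 \<le> \<theta> \<and> \<theta> \<le> 2 * pi \<longrightarrow>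
            cmod (gpolar G k r \<theta>) \<le> C * exp (T * \<bar>2 * pi * of_int k + \<theta>\<bar>)"
    and iv': "\<forall>k. uniform_limit {0..2*pi} (\<lambda>r \<theta>. gpolar G k r \<theta>) (\<lambda>_. 0) (at_right 0) \<and>
             uniform_limit {0..2*pi} (\<lambda>r \<theta>. gpolar G k r \<theta>) (\<lambda>_. 0) at_top"
    using assms unfolding MB2_def mem_Collect_eq by (elim conjE exE) (rule that; assumption)
  have hol: "G k analytic_on Omega" for k using hol' by simp
  have i: "bminus G k x = bplus G (k + 1) x" if "x > 0" for k x using i' that by simp
  have i0: "bplus G 0 x = complex_of_real (x powr c) * f x" if "x > 0" for x using i0' that by simp
  have ii: "psi G k analytic_on ball (complex_of_real x) \<rho>"
    if "x > 0" "\<rho> > 0" "ball (complex_of_real x) \<rho> \<subseteq> {z. Re z > 0}" for k x \<rho>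
    using ii' that by simp
  have iv: "uniform_limit {0..2*pi} (\<lambda>r \<theta>. gpolar G k r \<theta>) (\<lambda>_. 0) (at_right 0)"
    "uniform_limit {0..2*pi} (\<lambda>r \<theta>. gpolar G k r \<theta>) (\<lambda>_. 0) at_top" for k
    using iv' by simp_all
  have C: "cmod (gpolar G k r \<theta>) \<le> C * exp (T * \<bar>2 * pi * of_int k + \<theta>\<bar>)"
    if "r > 0" "0 \<le> \<theta>" "\<theta> \<le> 2 * pi" for k r \<theta> using iii that by simp
  define H where "H = entire_of_branches G"
  define h where "h = exp_pullback c f"
  have H: "H holomorphic_on UNIV" unfolding H_def by (rule entire_of_branches_holomorphic[OF hol i ii])
  have Hy: "H (of_real y) = h y" for y
    unfolding H_def entire_of_branches_of_real h_def using i0[of "exp y"] exp_pullback_eq[of "exp y" c f] by simp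
  have cont: "continuous_on {0<..} f"
  proof -
    have "continuous_on {0<..} (\<lambda>x. H (of_real (ln x)) * complex_of_real (x powr (- c)))"
      by (intro continuous_intros continuous_on_compose2[OF holomorphic_on_imp_continuous_on[OF H]]) auto
    also have "?this \<longleftrightarrow> continuous_on {0<..} f"
    proof (rule continuous_on_cong[OF refl])
      fix x :: real assume "x \<in> {0<..}"
      then have x: "x > 0" by simp
      have "H (of_real (ln x)) * complex_of_real (x powr (- c)) = f x * complex_of_real (x powr c * x powr (- c))"
        using exp_pullback_eq[OF x] by (simp add: Hy h_def)
      also have "x powr c * x powr (- c) = 1" using x by (simp flip: powr_add)
      finally show "H (of_real (ln x)) * complex_of_real (x powr (- c)) = f x" by simp
    qed
    finally show ?thesis .
  qed
  have conth: "continuous_on UNIV h" unfolding h_def by (rule exp_pullback_continuous[OF cont])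
  have L2: "(\<integral>\<^sup>+y. ennreal ((cmod (h y))\<^sup>2) \<partial>lborel) < \<infinity>"
    unfolding h_def by (rule exp_pullback_L2[OF X cont])
  obtain F r where F: "F \<in> borel_measurable lborel" and r: "strict_mono (r :: nat \<Rightarrow> nat)"
    and ae: "AE t in lborel. (\<lambda>n. fourier (truncate (real (r n)) h) t) \<longlonglongrightarrow> F t"
    and F2: "(\<integral>\<^sup>+t. ennreal ((cmod (F t))\<^sup>2) \<partial>lborel) < \<infinity>"
    and lim: "((\<lambda>R. \<integral>\<^sup>+t. ennreal ((cmod (fourier (truncate R h) t - F t))\<^sup>2) \<partial>lborel) \<longlongrightarrow> 0) at_top"
    using Plancherel_limit[OF conth L2] .
  have "((\<lambda>R. fourier (truncate R h) t) \<longlongrightarrow> 0) at_top" if "\<bar>t\<bar> > T" for t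
    using fourier_truncate_tendsto_0[OF H norm_entire_of_branches_le[OF C, folded H_def]
        entire_of_branches_tendsto_0(2)[OF iv, folded H_def] entire_of_branches_tendsto_0(1)[OF iv, folded H_def] that]
    by (simp add: Hy)
  then have lim0: "(\<lambda>n. fourier (truncate (real (r n)) h) t) \<longlonglongrightarrow> 0" if "\<bar>t\<bar> > T" for t
    using filterlim_compose[OF _ filterlim_compose[OF filterlim_real_sequentially filterlim_subseq[OF r]]] that by blast
  have "AE t in lborel. \<bar>t\<bar> > T \<longrightarrow> F t = 0"
    using ae by eventually_elim (use lim0 LIMSEQ_unique in blast)
  then have "AE t in lebesgue. \<bar>t\<bar> > T \<longrightarrow> F t = 0" by (rule AE_completion)
  moreover have "is_mellin_L2 c f F"
    unfolding is_mellin_L2_def using F F2 lim mellin_L2_limit_iff[OF cont, of F F c]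
    by (simp add: nn_integral_completion measurable_completion h_def)
  ultimately show ?thesis using X cont by (auto simp: B2_def)
qed

lemma B2_subset_MB2:
  assumes "T > 0" "f \<in> B2 c T"
  shows "f \<in> MB2 c T"
proof -
  from assms obtain F0 where X: "f \<in> X2 c" and cont: "continuous_on {0<..} f"
    and F0: "is_mellin_L2 c f F0" and supp0: "AE t in lebesgue. \<bar>t\<bar> > T \<longrightarrow> F0 t = 0"
    unfolding B2_def by blast
  define h where "h = exp_pullback c f"
  have conth: "continuous_on UNIV h" unfolding h_def by (rule exp_pullback_continuous[OF cont])
  have L2: "(\<integral>\<^sup>+y. ennreal ((cmod (h y))\<^sup>2) \<partial>lborel) < \<infinity>"
    unfolding h_def by (rule exp_pullback_L2[OF X cont])
  from F0 have "F0 \<in> borel_measurable lebesgue" by (simp add: is_mellin_L2_def)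
  then obtain F1 where F1: "F1 \<in> borel_measurable borel" "AE t in lborel. F0 t = F1 t"
    by (rule lebesgue_ex_borel_complex)
  \<comment> \<open>A Borel representative that vanishes everywhere outside \<open>[-T, T]\<close>,
    not just almost everywhere, as the lemmas on \<open>spectral_ext\<close> ask for.\<close>
  define F where "F = (\<lambda>t. if \<bar>t\<bar> > T then 0 else F1 t)"
  have F_meas [measurable]: "F \<in> borel_measurable borel" unfolding F_def using F1(1) by measurable
  have supp: "\<And>t. \<bar>t\<bar> > T \<Longrightarrow> F t = 0" by (simp add: F_def)
  have "AE t in lborel. \<bar>t\<bar> > T \<longrightarrow> F0 t = 0" using supp0 by (simp add: AE_completion_iff)
  with F1(2) have F0F: "AE t in lborel. F0 t = F t" by eventually_elim (auto simp: F_def)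
  have F2: "(\<integral>\<^sup>+t. ennreal ((cmod (F t))\<^sup>2) \<partial>lborel) < \<infinity>"
  proof -
    have "(\<integral>\<^sup>+t. ennreal ((cmod (F t))\<^sup>2) \<partial>lborel) = (\<integral>\<^sup>+t. ennreal ((cmod (F0 t))\<^sup>2) \<partial>lborel)"
      using F0F by (intro nn_integral_cong_AE) (auto elim: eventually_mono)
    then show ?thesis using F0 by (simp add: is_mellin_L2_def nn_integral_completion)
  qed
  have Fint: "integrable lborel F"
    by (rule integrable_of_square_compact_support[OF F_meas F2 supp])
  have "((\<lambda>R. \<integral>\<^sup>+t. ennreal ((cmod (fourier (truncate R h) t - F t))\<^sup>2) \<partial>lborel) \<longlongrightarrow> 0) at_top"
    unfolding h_def using F0 mellin_L2_limit_iff[OF cont F0F, of c] by (simp add: is_mellin_L2_def)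
  note inversion = fourier_inversion_L2[OF conth L2 Fint this]
  define H where "H = (\<lambda>w. spectral_ext F w / (2 * pi))"
  have H: "H holomorphic_on UNIV"
    unfolding H_def by (intro holomorphic_intros spectral_ext_holomorphic[OF Fint supp]) auto
  have Hy: "H (of_real y) = h y" for y
    by (simp add: H_def spectral_ext_of_real inversion)
  \<comment> \<open>The summand 1 keeps the constant strictly positive even when the spectrum is
    zero.\<close>
  define C where "C = (LBINT t. cmod (F t)) / (2 * pi) + 1"
  have C: "C > 0" unfolding C_def by (intro add_nonneg_pos divide_nonneg_pos integral_nonneg) auto
  have bound: "cmod (H w) \<le> C * exp (T * \<bar>Im w\<bar>)" for w
  proof -
    have "cmod (H w) = cmod (spectral_ext F w) / (2 * pi)" by (simp add: H_def norm_divide norm_mult)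
    also have "\<dots> \<le> (LBINT t. cmod (F t)) * exp (T * \<bar>Im w\<bar>) / (2 * pi)"
      by (intro divide_right_mono norm_spectral_ext_le[OF Fint supp]) auto
    also have "\<dots> \<le> C * exp (T * \<bar>Im w\<bar>)" by (simp add: C_def ring_distribs)
    finally show ?thesis .
  qed
  have decay: "\<exists>M. \<forall>u v. \<bar>u\<bar> \<ge> M \<longrightarrow> \<bar>v\<bar> \<le> V \<longrightarrow> cmod (H (Complex u v)) < e" if "e > 0" for V e
    by (rule entire_L2_decay[OF H bound _ _ that, of V]) (use L2 \<open>T > 0\<close> in \<open>auto simp: Hy\<close>)
  let ?G = "branches_of_entire H"
  have "\<forall>k. ?G k analytic_on Omega" by (simp add: branches_of_entire_analytic[OF H])
  moreover have "\<forall>k. \<forall>x>0.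
      (\<exists>l. ((\<lambda>\<epsilon>::real. ?G k (complex_of_real x + \<i> * complex_of_real \<epsilon>)) \<longlongrightarrow> l) (at_right 0)) \<and>
      (\<exists>l. ((\<lambda>\<epsilon>::real. ?G k (complex_of_real x - \<i> * complex_of_real \<epsilon>)) \<longlongrightarrow> l) (at_right 0)) \<and>
      bminus ?G k x = bplus ?G (k + 1) x"
  proof (intro allI impI conjI)
    fix k and x :: real assume x: "x > 0"
    show "\<exists>l. ((\<lambda>\<epsilon>::real. ?G k (complex_of_real x + \<i> * complex_of_real \<epsilon>)) \<longlongrightarrow> l) (at_right 0)"
      by (rule exI, rule branches_of_entire_tendsto_upper[OF H x])
    show "\<exists>l. ((\<lambda>\<epsilon>::real. ?G k (complex_of_real x - \<i> * complex_of_real \<epsilon>)) \<longlongrightarrow> l) (at_right 0)"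
      by (rule exI, rule branches_of_entire_tendsto_lower[OF H x])
    show "bminus ?G k x = bplus ?G (k + 1) x"
      using x by (simp only: bminus_branches_of_entire[OF H] bplus_branches_of_entire[OF H])
  qed
  moreover have "\<forall>x>0. bplus ?G 0 x = complex_of_real (x powr c) * f x"
  proof (intro allI impI)
    fix x :: real assume x: "x > 0"
    have "bplus ?G 0 x = H (of_real (ln x))"
      by (simp add: bplus_branches_of_entire[OF H x] complex_of_real_def)
    then show "bplus ?G 0 x = complex_of_real (x powr c) * f x"
      by (simp add: Hy h_def exp_pullback_eq[OF x])
  qed
  moreover have "\<forall>k. \<forall>x>0. \<forall>\<rho>>0. ball (complex_of_real x) \<rho> \<subseteq> {z. Re z > 0} \<longrightarrow>
      psi ?G k analytic_on ball (complex_of_real x) \<rho>"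
    using psi_branches_of_entire_analytic[OF H] by blast
  moreover have "\<exists>C>0. \<forall>k r \<theta>. r > 0 \<and> 0 \<le> \<theta> \<and> \<theta> \<le> 2 * pi \<longrightarrow>
      cmod (gpolar ?G k r \<theta>) \<le> C * exp (T * \<bar>2 * pi * of_int k + \<theta>\<bar>)"
  proof (intro exI[of _ C] conjI allI impI C)
    fix k :: int and r \<theta> :: real assume *: "r > 0 \<and> 0 \<le> \<theta> \<and> \<theta> \<le> 2 * pi"
    show "cmod (gpolar ?G k r \<theta>) \<le> C * exp (T * \<bar>2 * pi * of_int k + \<theta>\<bar>)"
      using * bound[of "Complex (ln r) (2 * pi * of_int k + \<theta>)"]
      by (simp add: gpolar_branches_of_entire[OF H])
  qed
  moreover have "\<forall>k. uniform_limit {0..2*pi} (\<lambda>r \<theta>. gpolar ?G k r \<theta>) (\<lambda>_. 0) (at_right 0) \<and>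
      uniform_limit {0..2*pi} (\<lambda>r \<theta>. gpolar ?G k r \<theta>) (\<lambda>_. 0) at_top"
    using uniform_limit_branches_of_entire[OF H decay] by blast
  ultimately show ?thesis
    unfolding MB2_def using X by (intro CollectI conjI exI[of _ ?G])
qed

theorem theorem3:
  fixes c T :: real
  assumes "T > 0"
  shows "MB2 c T = B2 c T"
  using MB2_subset_B2 B2_subset_MB2[OF assms] by blast

end
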